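(* Let $X$ be a Banach space, let $A:D(A)\subset X\to X$ be the generator of a $C_0$-semigroup $(S(t))_{t\ge0}$ on $X$ with exponential growth bound $\omega_0<0$, and let $\alpha\in(0,1]$. If $\omega>\omega_0$ and $x\in F_\alpha$, then $$S(t)x-e^{\omega_0t}x=\frac{1}{2\pi i}\lim_{R\to\infty}\int_{\omega-iR}^{\omega+iR}e^{\lambda t}\left((\lambda-A)^{-1}-\frac{1}{\lambda-\omega_0}\right)x\,d\lambda\quad\text{locally uniformly in } t\in[0,\infty)$$ and $$S(t)x=\frac{1}{2\pi i}\lim_{R\to\infty}\int_{\omega-iR}^{\omega+iR}e^{\lambda t}(\lambda-A)^{-1}x\,d\lambda\quad\text{locally uniformly in } t\in(0,\infty),$$ where in both formulas the convergence holds in the $X$-norm and in the $F_{\alpha'}$-norm for any $\alpha'\in(0,\alpha)$.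
   Context: $X$ is a Banach space with complex scalars and norm $\|\cdot\|_X$. The semigroup has exponential growth bound $\omega_0$ if there exists $C>0$ with $\|S(t)\|\le Ce^{\omega_0t}$ (operator norm on $X$) for all $t\ge0$. For $\beta\in(0,1]$ the Favard space is $F_\beta:=\{x\in X:\|x\|_{F_\beta}<\infty\}$ with $\|x\|_{F_\beta}:=\sup_{t>0}\frac{1}{t^\beta}\|S(t)x-x\|_X$; it is a Banach space with respect to $\|\cdot\|_{F_\beta}$, and $F_\beta\subset F_{\beta'}$ for $0<\beta'\le\beta\le1$. The integral from $\omega-iR$ to $\omega+iR$ is along the vertical segment. Locally uniformly in $t\in I$ means uniformly on every compact subset of $I$. *)

theory Defs
  imports "HOL-Complex_Analysis.Complex_Analysis"
begin

text \<open>Complex Banach spaces: a real Banach space with a compatible multiplication by complex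
  scalars for which the norm is homogeneous.\<close>

class complex_normed_vector = real_normed_vector +
  fixes scaleC :: "complex \<Rightarrow> 'a \<Rightarrow> 'a"  (infixr \<open>*\<^sub>C\<close> 75)
  assumes scaleC_add_right: "c *\<^sub>C (x + y) = c *\<^sub>C x + c *\<^sub>C y"
    and scaleC_add_left: "(c + d) *\<^sub>C x = c *\<^sub>C x + d *\<^sub>C x"
    and scaleC_scaleC: "c *\<^sub>C (d *\<^sub>C x) = (c * d) *\<^sub>C x"
    and scaleC_of_real: "complex_of_real r *\<^sub>C x = r *\<^sub>R x"
    and norm_scaleC: "norm (c *\<^sub>C x) = cmod c * norm x"

class cbanach = complex_normed_vector + banach

instantiation complex :: cbanach
begin

definition scaleC_complex :: "complex \<Rightarrow> complex \<Rightarrow> complex" where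
  "scaleC_complex c x = c * x"

instance
  by standard (simp_all add: scaleC_complex_def algebra_simps norm_mult scaleR_conv_of_real)

end

definition bounded_clinear :: "('a::complex_normed_vector \<Rightarrow> 'b::complex_normed_vector) \<Rightarrow> bool"
  where "bounded_clinear f \<longleftrightarrow> bounded_linear f \<and> (\<forall>c x. f (c *\<^sub>C x) = c *\<^sub>C f x)"

text \<open>Semigroups are total functions on \<^typ>\<open>real\<close>; only their values at nonnegative times
  are constrained or used.\<close>

definition C0_semigroup :: "(real \<Rightarrow> 'a::complex_normed_vector \<Rightarrow> 'a) \<Rightarrow> bool" where
  "C0_semigroup S \<longleftrightarrow>
     (\<forall>t\<ge>0. bounded_clinear (S t)) \<and>
     (\<forall>x. S 0 x = x) \<and>
     (\<forall>s\<ge>0. \<forall>t\<ge>0. \<forall>x. S (s + t) x = S s (S t x)) \<and>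
     (\<forall>x. ((\<lambda>t. S t x) \<longlongrightarrow> x) (at_right 0))"

text \<open>The unbounded operator \<open>A\<close> with domain \<open>D\<close> is the generator of \<open>S\<close>;
  values of \<open>A\<close> outside \<open>D\<close> are irrelevant.\<close>

definition is_generator ::
  "'a set \<Rightarrow> ('a \<Rightarrow> 'a) \<Rightarrow> (real \<Rightarrow> 'a::complex_normed_vector \<Rightarrow> 'a) \<Rightarrow> bool" where
  "is_generator D A S \<longleftrightarrow>
     D = {x. \<exists>y. ((\<lambda>h. (1 / h) *\<^sub>R (S h x - x)) \<longlongrightarrow> y) (at_right 0)} \<and>
     (\<forall>x\<in>D. ((\<lambda>h. (1 / h) *\<^sub>R (S h x - x)) \<longlongrightarrow> A x) (at_right 0))"

text \<open>Existence of some constant only: \<open>w\<close> need not be the infimum of admissible exponents.\<close>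

definition exp_growth_bound :: "(real \<Rightarrow> 'a::complex_normed_vector \<Rightarrow> 'a) \<Rightarrow> real \<Rightarrow> bool" where
  "exp_growth_bound S w \<longleftrightarrow> (\<exists>C>0. \<forall>t\<ge>0. onorm (S t) \<le> C * exp (w * t))"

text \<open>The inverse of \<open>\<lambda> - A : D \<rightarrow> X\<close>; meaningful when this map is a bijection.\<close>

definition resolvent ::
  "'a set \<Rightarrow> ('a \<Rightarrow> 'a) \<Rightarrow> complex \<Rightarrow> 'a::complex_normed_vector \<Rightarrow> 'a" where
  "resolvent D A z = inv_into D (\<lambda>x. z *\<^sub>C x - A x)"

text \<open>The supremum is taken in \<^typ>\<open>ennreal\<close>, so it is \<open>\<infinity>\<close> outside the Favard space.\<close>

definition favard_norm ::
  "(real \<Rightarrow> 'a::complex_normed_vector \<Rightarrow> 'a) \<Rightarrow> real \<Rightarrow> 'a \<Rightarrow> ennreal" where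
  "favard_norm S b x = (SUP t\<in>{0<..}. ennreal (1 / t powr b * norm (S t x - x)))"

definition favard_space ::
  "(real \<Rightarrow> 'a::complex_normed_vector \<Rightarrow> 'a) \<Rightarrow> real \<Rightarrow> 'a set" where
  "favard_space S b = {x. favard_norm S b x < \<infinity>}"

text \<open>Vector-valued version of \<^const>\<open>contour_integral\<close>.\<close>

definition vcontour_integral ::
  "(complex \<Rightarrow> 'a::complex_normed_vector) \<Rightarrow> (real \<Rightarrow> complex) \<Rightarrow> 'a" where
  "vcontour_integral f g =
     integral {0..1} (\<lambda>s. vector_derivative g (at s within {0..1}) *\<^sub>C f (g s))"

definition loc_uniform_limit ::
  "'t::topological_space set \<Rightarrow> ('r \<Rightarrow> 't \<Rightarrow> 'a::metric_space) \<Rightarrow> ('t \<Rightarrow> 'a) \<Rightarrow> 'r filter \<Rightarrow> bool"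
  where "loc_uniform_limit I f l F \<longleftrightarrow> (\<forall>K. compact K \<and> K \<subseteq> I \<longrightarrow> uniform_limit K f l F)"

text \<open>Convergence in the Favard space: the limit lies in it, and since the norm is
  \<^typ>\<open>ennreal\<close>-valued, the estimate forces \<open>f r t\<close> for \<open>t \<in> K\<close> to lie in it as well,
  eventually in \<open>r\<close>.\<close>

definition favard_loc_uniform_limit ::
  "(real \<Rightarrow> 'a::complex_normed_vector \<Rightarrow> 'a) \<Rightarrow> real \<Rightarrow> 't::topological_space set \<Rightarrow>
   ('r \<Rightarrow> 't \<Rightarrow> 'a) \<Rightarrow> ('t \<Rightarrow> 'a) \<Rightarrow> 'r filter \<Rightarrow> bool" where
  "favard_loc_uniform_limit S b I f l F \<longleftrightarrow>
     (\<forall>t\<in>I. l t \<in> favard_space S b) \<and>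
     (\<forall>K. compact K \<and> K \<subseteq> I \<longrightarrow>
       (\<forall>e::real. e > 0 \<longrightarrow> (\<forall>\<^sub>F r in F. \<forall>t\<in>K. favard_norm S b (f r t - l t) < ennreal e)))"

end

theory Submission
  imports Defs "HOL-Probability.Sinc_Integral"
begin

text \<open>
  Put \<open>f(s) = e\<^bsup>-\<omega>s\<^esup> (S(s)x - \<kappa> e\<^bsup>\<omega>\<^sub>0s\<^esup> x)\<close> for \<open>s \<ge> 0\<close>, where \<open>\<kappa> = 1\<close> for the first
  formula and \<open>\<kappa> = 0\<close> for the second. The resolvent is the Laplace transform of the semigroup
  (\<open>resolvent_eq_laplace\<close>), so on the line \<open>Re \<lambda> = \<omega>\<close> the integrand is, up to the factor
  \<open>e\<^bsup>\<lambda>t\<^esup>\<close>, the Fourier transform of \<open>f\<close>, and both formulas say that the truncated Fourier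
  inversion integral of \<open>f\<close> at \<open>t\<close>, multiplied by \<open>e\<^bsup>\<omega>t\<^esup>\<close>, recovers \<open>e\<^bsup>\<omega>t\<^esup> f(t)\<close>. By Fubini that
  integral is \<open>\<integral> f(s) sin(R(s - t)) / (\<pi>(s - t)) ds\<close>.

  Membership of \<open>x\<close> in a Favard space makes \<open>f\<close> Hoelder continuous on the half line, with
  exponentially decaying constants (\<open>decaying_hoelder_damped_orbit\<close>). Near \<open>t\<close> this makes the kernel
  integrable against \<open>f(s) - f(t)\<close>, uniformly in \<open>R\<close>, while \<open>f(t)\<close> itself is reproduced because the
  sine integral tends to \<open>\<pi>/2\<close>. Away from \<open>t\<close> the oscillation gives smallness, at a rate that
  depends on the Hoelder constants only. The only obstruction is the jump of \<open>f\<close> at \<open>0\<close>, where \<open>f\<close> is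
  cut off: it is absent for \<open>\<kappa> = 1\<close>, which allows \<open>t\<close> to reach \<open>0\<close>, and for \<open>\<kappa> = 0\<close> one has to
  keep \<open>t\<close> away from it. The resulting theorem \<open>uniform_fourier_inversion\<close> bounds the error by
  \<open>e M\<close>, where \<open>M\<close> is the Hoelder constant and the threshold for \<open>R\<close> depends on neither the
  function nor the point.

  This uniformity in the function also yields convergence in the Favard norms. The error operator
  commutes with \<open>S(h)\<close>, hence the Favard norm of the error of \<open>x\<close> is governed by the error of the
  increments \<open>S(h)x - x\<close>. For \<open>x \<in> F\<^sub>\<alpha>\<close> and \<open>\<beta> < \<alpha>\<close> such an increment lies in
  \<open>F\<^bsub>\<alpha> - \<beta>\<^esub>\<close> with norm of order \<open>h\<^sup>\<beta>\<close> (\<open>increment_hoelder\<close>), so its error is at most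
  \<open>e h\<^sup>\<beta>\<close> up to a constant, which is exactly what the \<open>F\<^sub>\<beta>\<close>-norm measures.
\<close>

section \<open>Multiplication by complex scalars\<close>

lemma bounded_bilinear_scaleC: "bounded_bilinear (scaleC :: complex \<Rightarrow> 'a::complex_normed_vector \<Rightarrow> 'a)"
proof
  fix r :: real and c :: complex and x :: 'a
  show "(r *\<^sub>R c) *\<^sub>C x = r *\<^sub>R (c *\<^sub>C x)"
    by (simp add: scaleR_conv_of_real scaleC_scaleC[symmetric] scaleC_of_real)
  have "c *\<^sub>C r *\<^sub>R x = c *\<^sub>C complex_of_real r *\<^sub>C x" by (simp add: scaleC_of_real)
  also have "\<dots> = complex_of_real r *\<^sub>C c *\<^sub>C x" by (simp add: scaleC_scaleC mult.commute)
  finally show "c *\<^sub>C r *\<^sub>R x = r *\<^sub>R c *\<^sub>C x" by (simp add: scaleC_of_real)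
  show "\<exists>K. \<forall>a b. norm (a *\<^sub>C b :: 'a) \<le> norm a * norm b * K"
    by (rule exI[of _ 1]) (simp add: norm_scaleC)
qed (simp_all add: scaleC_add_left scaleC_add_right)

lemmas scaleC_continuous_intros [continuous_intros] =
  bounded_bilinear.continuous_on[OF bounded_bilinear_scaleC]

lemmas bounded_linear_scaleC_left = bounded_bilinear.bounded_linear_left[OF bounded_bilinear_scaleC]
lemmas bounded_linear_scaleC_right = bounded_bilinear.bounded_linear_right[OF bounded_bilinear_scaleC]
lemmas scaleC_diff_right = bounded_bilinear.diff_right[OF bounded_bilinear_scaleC]
lemmas scaleC_diff_left = bounded_bilinear.diff_left[OF bounded_bilinear_scaleC]

lemma scaleC_zero [simp]:
  "0 *\<^sub>C x = 0" "c *\<^sub>C (0::'a::complex_normed_vector) = 0"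
  by (simp_all add: bounded_bilinear.zero_left[OF bounded_bilinear_scaleC]
      bounded_bilinear.zero_right[OF bounded_bilinear_scaleC])

lemma scaleC_one [simp]: "1 *\<^sub>C x = (x::'a::complex_normed_vector)"
  using scaleC_of_real[of 1 x] by simp

lemma scaleC_scaleR: "c *\<^sub>C (r *\<^sub>R x) = (c * of_real r) *\<^sub>C (x::'a::complex_normed_vector)"
  by (simp add: scaleC_of_real[symmetric] scaleC_scaleC)

lemma scaleR_scaleC: "r *\<^sub>R (c *\<^sub>C x) = (of_real r * c) *\<^sub>C (x::'a::complex_normed_vector)"
  by (simp add: scaleC_of_real[symmetric] scaleC_scaleC)

section \<open>Improper integrals with exponential decay\<close>

lemma tendsto_exp_neg_mult_at_top:
  fixes \<epsilon> :: real
  assumes "\<epsilon> > 0"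
  shows "((\<lambda>N. exp (- (\<epsilon> * N))) \<longlongrightarrow> 0) at_top"
  using assms
  by (intro filterlim_compose[OF exp_at_bot] filterlim_uminus_at_bot_at_top[THEN filterlim_compose]
      filterlim_tendsto_pos_mult_at_top[OF tendsto_const _ filterlim_ident])

text \<open>Integrals over the half line are handled through their truncations: a Banach-valued function
  with an integrable exponential majorant has a limit, and the explicit tail bound allows the
  truncation to be removed uniformly in a parameter later on.\<close>
lemma improper_integral_exp_tail:
  fixes f :: "real \<Rightarrow> 'a::banach"
  assumes cont: "continuous_on {0..} f" and e: "\<epsilon> > 0" and M: "M \<ge> 0"
    and bnd: "\<And>s. s \<ge> 0 \<Longrightarrow> norm (f s) \<le> M * exp (- \<epsilon> * s)"
  obtains F where "((\<lambda>N. integral {0..N} f) \<longlongrightarrow> F) at_top"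
    and "\<And>N. N \<ge> 0 \<Longrightarrow> norm (F - integral {0..N} f) \<le> M * exp (- \<epsilon> * N) / \<epsilon>"
proof -
  have int: "f integrable_on {a..b}" if "a \<ge> 0" for a b
    by (rule integrable_continuous_real, rule continuous_on_subset[OF cont]) (use that in auto)
  have diff: "norm (integral {0..N'} f - integral {0..N} f) \<le> M * exp (- \<epsilon> * N) / \<epsilon>"
    if N: "0 \<le> N" "N \<le> N'" for N N'
  proof -
    have g: "((\<lambda>s. M * exp (- \<epsilon> * s)) has_integral (- (M * exp (- \<epsilon> * N') / \<epsilon>) - - (M * exp (- \<epsilon> * N) / \<epsilon>))) {N..N'}"
      using e N(2) by (intro fundamental_theorem_of_calculus)
        (auto intro!: derivative_eq_intros simp: has_real_derivative_iff_has_vector_derivative[symmetric])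
    have "integral {0..N'} f - integral {0..N} f = integral {N..N'} f"
      using Henstock_Kurzweil_Integration.integral_combine[of 0 N N' f, symmetric] int N by simp
    then have "norm (integral {0..N'} f - integral {0..N} f) \<le> integral {N..N'} (\<lambda>s. M * exp (- \<epsilon> * s))"
      using N bnd int has_integral_integrable[OF g]
      by (simp only:) (rule Henstock_Kurzweil_Integration.integral_norm_bound_integral, auto)
    also have "\<dots> \<le> M * exp (- \<epsilon> * N) / \<epsilon>"
      unfolding integral_unique[OF g] using M e by simp
    finally show ?thesis .
  qed
  have lim0: "((\<lambda>N. M * exp (- \<epsilon> * N) / \<epsilon>) \<longlongrightarrow> 0) at_top"
    using tendsto_mult_right_zero[OF tendsto_exp_neg_mult_at_top[OF e], of "M / \<epsilon>"] by simp
  have "Cauchy (\<lambda>n. integral {0..real n} f)"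
  proof (rule metric_CauchyI)
    fix r :: real assume "r > 0"
    from order_tendstoD(2)[OF lim0 this] eventually_ge_at_top[of 0]
    have "\<forall>\<^sub>F N in at_top. M * exp (- \<epsilon> * N) / \<epsilon> < r \<and> N \<ge> 0" by (rule eventually_conj)
    then obtain N0 where N0: "\<And>N. N \<ge> N0 \<Longrightarrow> M * exp (- \<epsilon> * N) / \<epsilon> < r \<and> N \<ge> 0"
      by (auto simp: eventually_at_top_linorder)
    have "dist (integral {0..real m} f) (integral {0..real n} f) < r"
      if "nat \<lceil>N0\<rceil> \<le> m" "nat \<lceil>N0\<rceil> \<le> n" for m n
    proof (cases "m \<le> n")
      case True
      then show ?thesis using diff[of "real m" "real n"] N0[of "real m"] that
        by (simp add: dist_norm norm_minus_commute)
    next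
      case False
      then show ?thesis using diff[of "real n" "real m"] N0[of "real n"] that
        by (simp add: dist_norm)
    qed
    then show "\<exists>k. \<forall>m\<ge>k. \<forall>n\<ge>k. dist (integral {0..real m} f) (integral {0..real n} f) < r" by blast
  qed
  then obtain F where F: "(\<lambda>n. integral {0..real n} f) \<longlonglongrightarrow> F"
    by (auto simp: Cauchy_convergent_iff convergent_def)
  have tail: "norm (F - integral {0..N} f) \<le> M * exp (- \<epsilon> * N) / \<epsilon>" if "N \<ge> 0" for N
  proof (rule tendsto_upperbound)
    show "(\<lambda>n. norm (integral {0..real n} f - integral {0..N} f)) \<longlonglongrightarrow> norm (F - integral {0..N} f)"
      by (intro tendsto_intros F)
    have "\<forall>\<^sub>F n in sequentially. N \<le> real n"
      using filterlim_real_sequentially by (simp add: filterlim_at_top)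
    then show "\<forall>\<^sub>F n in sequentially. norm (integral {0..real n} f - integral {0..N} f) \<le> M * exp (- \<epsilon> * N) / \<epsilon>"
      by eventually_elim (rule diff[OF that])
  qed simp
  have "((\<lambda>N. integral {0..N} f - F) \<longlongrightarrow> 0) at_top"
    by (rule Lim_null_comparison[OF _ lim0])
      (use tail in \<open>auto intro!: eventually_mono[OF eventually_ge_at_top[of 0]] simp: norm_minus_commute\<close>)
  then show ?thesis using that[of F] tail by (simp add: LIM_zero_iff)
qed

section \<open>The sinc kernel and the Riemann-Lebesgue estimate\<close>

text \<open>A Riemann-Lebesgue lemma with a rate. Translating by half a period flips the sign of the sine,
  so twice the integral equals the integral against the increments of \<open>q\<close>, up to two boundary strips
  of length \<open>h\<close>. The bound therefore depends on the modulus of continuity of \<open>q\<close> alone and is uniform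
  over classes of functions.\<close>
lemma integral_sin_half_period_shift:
  fixes q :: "real \<Rightarrow> 'a::banach"
  assumes R: "R > 0" and h: "h = pi / R" and ab: "a \<le> b"
    and cont: "continuous_on {a..b + h} q"
    and bnd: "\<And>s. s \<in> {a..b + h} \<Longrightarrow> norm (q s) \<le> B"
    and diff: "\<And>s. s \<in> {a..b} \<Longrightarrow> norm (q (s + h) - q s) \<le> g s"
    and g: "(g has_integral J) {a..b}"
  shows "2 * norm (integral {a..b} (\<lambda>s. sin (R * (s - t)) *\<^sub>R q s)) \<le> J + 2 * h * B"
proof -
  define p where "p = (\<lambda>s. sin (R * (s - t)) *\<^sub>R q s)"
  have h0: "h > 0" using R h by simp
  have contp: "continuous_on {a..b + h} p"
    unfolding p_def by (intro continuous_intros cont)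
  have int: "p integrable_on {c..d}" if "a \<le> c" "d \<le> b + h" for c d
    by (rule integrable_continuous_real, rule continuous_on_subset[OF contp]) (use that in auto)
  have flip: "p (h + s) = - (sin (R * (s - t)) *\<^sub>R q (s + h))" for s
  proof -
    have "R * (h + s - t) = R * (s - t) + pi"
      using R h by (simp add: field_simps)
    then show ?thesis by (simp add: p_def add.commute)
  qed
  have "integral {a..b} (p \<circ> ((+) h)) = integral {a + h..b + h} p"
    by (rule integral_shift_Icc_real)
  moreover have "p \<circ> ((+) h) = (\<lambda>s. - (sin (R * (s - t)) *\<^sub>R q (s + h)))"
    by (auto simp: fun_eq_iff flip)
  ultimately have shifted: "integral {a + h..b + h} p
      = - integral {a..b} (\<lambda>s. sin (R * (s - t)) *\<^sub>R q (s + h))"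
    by simp
  have split1: "integral {a..b + h} p = integral {a..b} p + integral {b..b + h} p"
    using Henstock_Kurzweil_Integration.integral_combine[of a b "b + h" p] int ab h0 by simp
  have split2: "integral {a..b + h} p = integral {a..a + h} p + integral {a + h..b + h} p"
    using Henstock_Kurzweil_Integration.integral_combine[of a "a + h" "b + h" p] int ab h0 by simp
  have contshift: "continuous_on {a..b} (\<lambda>s. q (s + h))"
    by (rule continuous_on_compose2[OF cont]) (use h0 in \<open>auto intro!: continuous_intros\<close>)
  have contq: "continuous_on {a..b} q"
    by (rule continuous_on_subset[OF cont]) (use h0 in auto)
  have i1: "(\<lambda>s. sin (R * (s - t)) *\<^sub>R q (s + h)) integrable_on {a..b}"
    by (intro integrable_continuous_real continuous_intros contshift)
  have "integral {a..b} (\<lambda>s. sin (R * (s - t)) *\<^sub>R (q (s + h) - q s))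
      = integral {a..b} (\<lambda>s. sin (R * (s - t)) *\<^sub>R q (s + h)) - integral {a..b} p"
    using Henstock_Kurzweil_Integration.integral_diff[OF i1 int[of a b]] h0 by (simp add: p_def algebra_simps)
  then have key: "2 *\<^sub>R integral {a..b} p = integral {a..a + h} p - integral {b..b + h} p
      - integral {a..b} (\<lambda>s. sin (R * (s - t)) *\<^sub>R (q (s + h) - q s))"
    using split1 split2 shifted by (simp add: scaleR_2 algebra_simps)
  have small: "norm (p s) \<le> B" if "s \<in> {a..b + h}" for s
  proof -
    have "norm (p s) = \<bar>sin (R * (s - t))\<bar> * norm (q s)" by (simp add: p_def)
    also have "\<dots> \<le> 1 * norm (q s)" by (intro mult_right_mono) auto
    finally show ?thesis using bnd[OF that] by simp
  qed
  have b1: "norm (integral {a..a + h} p) \<le> B * h"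
  proof -
    have "norm (integral {a..a + h} p) \<le> B * (a + h - a)"
      by (rule integral_bound) (use h0 ab small in \<open>auto intro: continuous_on_subset[OF contp]\<close>)
    then show ?thesis by simp
  qed
  have b2: "norm (integral {b..b + h} p) \<le> B * h"
  proof -
    have "norm (integral {b..b + h} p) \<le> B * (b + h - b)"
      by (rule integral_bound) (use h0 ab small in \<open>auto intro: continuous_on_subset[OF contp]\<close>)
    then show ?thesis by simp
  qed
  have b3: "norm (integral {a..b} (\<lambda>s. sin (R * (s - t)) *\<^sub>R (q (s + h) - q s))) \<le> integral {a..b} g"
  proof (rule Henstock_Kurzweil_Integration.integral_norm_bound_integral)
    show "(\<lambda>s. sin (R * (s - t)) *\<^sub>R (q (s + h) - q s)) integrable_on {a..b}"
      by (intro integrable_continuous_real continuous_intros contshift contq)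
    show "g integrable_on {a..b}" using g by (rule has_integral_integrable)
    fix s assume s: "s \<in> {a..b}"
    have "norm (sin (R * (s - t)) *\<^sub>R (q (s + h) - q s)) \<le> 1 * norm (q (s + h) - q s)"
      unfolding norm_scaleR by (intro mult_right_mono) auto
    then show "norm (sin (R * (s - t)) *\<^sub>R (q (s + h) - q s)) \<le> g s" using diff[OF s] by simp
  qed
  have "2 * norm (integral {a..b} p) = norm (2 *\<^sub>R integral {a..b} p)" by simp
  also have "\<dots> \<le> norm (integral {a..a + h} p) + norm (integral {b..b + h} p)
      + norm (integral {a..b} (\<lambda>s. sin (R * (s - t)) *\<^sub>R (q (s + h) - q s)))"
    unfolding key by (meson norm_triangle_ineq4 norm_triangle_le_diff add_mono order_trans order_refl)
  also have "\<dots> \<le> J + 2 * h * B"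
    using b1 b2 b3 integral_unique[OF g] by (simp add: mult.commute)
  finally show ?thesis unfolding p_def .
qed

text \<open>The Dirichlet kernel \<open>sin(Ru) / (\<pi>u)\<close> of the real line, written so that it is continuous
  at \<open>u = 0\<close>.\<close>
definition sinc_kernel :: "real \<Rightarrow> real \<Rightarrow> real" where
  "sinc_kernel R u = R / pi * sinc (R * u)"

lemma continuous_on_sinc_kernel [continuous_intros]:
  "continuous_on A f \<Longrightarrow> continuous_on A (\<lambda>s. sinc_kernel R (f s))"
  unfolding sinc_kernel_def by (intro continuous_intros)

lemma sinc_kernel_minus [simp]: "sinc_kernel R (- u) = sinc_kernel R u"
  by (simp add: sinc_kernel_def)

lemma sinc_kernel_eq: "R > 0 \<Longrightarrow> u \<noteq> 0 \<Longrightarrow> sinc_kernel R u = sin (R * u) / (pi * u)"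
  by (simp add: sinc_kernel_def)

lemma abs_sinc_kernel_le:
  assumes "R > 0" "u \<noteq> 0"
  shows "\<bar>sinc_kernel R u\<bar> \<le> 1 / (pi * \<bar>u\<bar>)"
  using assms by (simp add: sinc_kernel_eq abs_mult divide_right_mono)

lemma has_integral_sinc_kernel:
  assumes "a \<le> b"
  shows "((\<lambda>s. sinc_kernel R (s - t)) has_integral (Si (R * (b - t)) - Si (R * (a - t))) / pi) {a..b}"
proof -
  have "((\<lambda>s. Si (R * (s - t)) / pi) has_real_derivative sinc_kernel R (s - t)) (at s)" for s
    unfolding sinc_kernel_def
    by (rule derivative_eq_intros DERIV_chain2[OF DERIV_Si] refl | simp)+
  then have "((\<lambda>s. sinc_kernel R (s - t)) has_integral Si (R * (b - t)) / pi - Si (R * (a - t)) / pi) {a..b}"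
    by (intro fundamental_theorem_of_calculus assms)
      (auto simp: has_real_derivative_iff_has_vector_derivative intro: has_vector_derivative_at_within)
  then show ?thesis by (simp add: diff_divide_distrib)
qed

lemma has_integral_cis_sinc_kernel:
  assumes "R > 0"
  shows "((\<lambda>\<eta>. cis (\<eta> * u)) has_integral of_real (2 * pi * sinc_kernel R u)) {- R..R}"
proof (cases "u = 0")
  case True
  have "((\<lambda>\<eta>. 1::complex) has_integral of_real (R - - R)) {- R..R}"
    using has_integral_const_real[of "1::complex" "-R" R] assms by (simp add: scaleR_conv_of_real)
  then show ?thesis using assms True by (simp add: sinc_kernel_def)
next
  case False
  have "((\<lambda>\<eta>. cis (\<eta> * u) / (\<i> * of_real u)) has_vector_derivative cis (\<eta> * u)) (at \<eta> within {- R..R})" for \<eta>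
  proof -
    have 1: "((\<lambda>z. exp (\<i> * (z * of_real u)) / (\<i> * of_real u)) has_field_derivative
        exp (\<i> * (of_real \<eta> * of_real u))) (at (of_real \<eta>))"
      using False by (auto intro!: derivative_eq_intros simp: mult_ac)
    show ?thesis
      using has_vector_derivative_real_field[OF 1, of "{-R..R}"] by (simp add: cis_conv_exp mult_ac)
  qed
  then have *: "((\<lambda>\<eta>. cis (\<eta> * u)) has_integral cis (R * u) / (\<i> * of_real u) - cis (- R * u) / (\<i> * of_real u)) {- R..R}"
    using assms by (intro fundamental_theorem_of_calculus) auto
  have "cis (R * u) / (\<i> * of_real u) - cis (- R * u) / (\<i> * of_real u) = of_real (2 * pi * sinc_kernel R u)"
    using False assms by (auto simp: sinc_kernel_eq complex_eq_iff field_simps Re_divide Im_divide power2_eq_square)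
  then show ?thesis using * by simp
qed

section \<open>Quantitative Fourier inversion\<close>

lemma has_integral_abs_powr:
  fixes a b t \<gamma> :: real
  assumes "\<gamma> > -1" "a \<le> t" "t \<le> b"
  shows "((\<lambda>s. \<bar>s - t\<bar> powr \<gamma>) has_integral
     ((t - a) powr (\<gamma> + 1) + (b - t) powr (\<gamma> + 1)) / (\<gamma> + 1)) {a..b}"
proof -
  have pow: "((\<lambda>x. \<bar>x\<bar> powr \<gamma>) has_integral (c powr (\<gamma> + 1) / (\<gamma> + 1))) {0..c}" if "c \<ge> 0" for c
    by (rule has_integral_eq[OF _ has_integral_powr_from_0[OF assms(1) that]]) auto
  have right: "((\<lambda>s. \<bar>s - t\<bar> powr \<gamma>) has_integral ((b - t) powr (\<gamma> + 1) / (\<gamma> + 1))) {t..b}"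
    using has_integral_shift_Icc_real[of "\<lambda>s. \<bar>s - t\<bar> powr \<gamma>" t _ 0 "b - t"] pow[of "b - t"] assms
    by (simp add: o_def)
  have "((\<lambda>x. \<bar>- x\<bar> powr \<gamma>) has_integral ((t - a) powr (\<gamma> + 1) / (\<gamma> + 1))) {- (t - a)..- 0}"
    unfolding has_integral_reflect_real[of "\<lambda>x. \<bar>x\<bar> powr \<gamma>"] using pow[of "t - a"] assms by simp
  then have left: "((\<lambda>s. \<bar>s - t\<bar> powr \<gamma>) has_integral ((t - a) powr (\<gamma> + 1) / (\<gamma> + 1))) {a..t}"
    using has_integral_shift_Icc_real[of "\<lambda>s. \<bar>s - t\<bar> powr \<gamma>" t _ "a - t" 0]
    by (simp add: o_def)
  show ?thesis
    using has_integral_combine[OF assms(2,3) left right] by (simp add: add_divide_distrib)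
qed

text \<open>The Dini argument: the kernel is at most \<open>1 / (\<pi>\<bar>s - t\<bar>)\<close>, and this singularity
  is integrable once it is multiplied by the Hoelder modulus \<open>\<bar>s - t\<bar>\<^sup>\<beta>\<close>. No cancellation is used, hence
  the bound does not depend on \<open>R\<close>.\<close>
lemma norm_integral_sinc_kernel_near:
  fixes f :: "real \<Rightarrow> 'a::banach"
  assumes R: "R > 0" and b: "\<beta> > 0" and d: "\<delta> > 0" and M: "M \<ge> 0"
    and t: "a \<le> t" "t \<le> b" "t - a \<le> \<delta>" "b - t \<le> \<delta>"
    and cont: "continuous_on {a..b} f"
    and hoelder: "\<And>s. s \<in> {a..b} \<Longrightarrow> norm (f s - f t) \<le> M * \<bar>s - t\<bar> powr \<beta>"
  shows "norm (integral {a..b} (\<lambda>s. sinc_kernel R (s - t) *\<^sub>R (f s - f t))) \<le> 2 * M * \<delta> powr \<beta> / (pi * \<beta>)"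
proof -
  have g: "((\<lambda>s. M / pi * \<bar>s - t\<bar> powr (\<beta> - 1)) has_integral
      M / pi * (((t - a) powr \<beta> + (b - t) powr \<beta>) / \<beta>)) {a..b}"
    using has_integral_mult_right[OF has_integral_abs_powr[of "\<beta> - 1" a t b], of "M / pi"] b t by simp
  have "norm (integral {a..b} (\<lambda>s. sinc_kernel R (s - t) *\<^sub>R (f s - f t)))
      \<le> integral {a..b} (\<lambda>s. M / pi * \<bar>s - t\<bar> powr (\<beta> - 1))"
  proof (rule Henstock_Kurzweil_Integration.integral_norm_bound_integral)
    show "(\<lambda>s. sinc_kernel R (s - t) *\<^sub>R (f s - f t)) integrable_on {a..b}"
      by (intro integrable_continuous_real continuous_intros cont)
    show "(\<lambda>s. M / pi * \<bar>s - t\<bar> powr (\<beta> - 1)) integrable_on {a..b}"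
      using g by (rule has_integral_integrable)
    fix s assume s: "s \<in> {a..b}"
    show "norm (sinc_kernel R (s - t) *\<^sub>R (f s - f t)) \<le> M / pi * \<bar>s - t\<bar> powr (\<beta> - 1)"
    proof (cases "s = t")
      case False
      have "norm (sinc_kernel R (s - t) *\<^sub>R (f s - f t))
          \<le> 1 / (pi * \<bar>s - t\<bar>) * (M * \<bar>s - t\<bar> powr \<beta>)"
        unfolding norm_scaleR
        by (intro mult_mono abs_sinc_kernel_le R hoelder s) (use False in auto)
      also have "\<dots> = M / pi * \<bar>s - t\<bar> powr (\<beta> - 1)"
        using False by (simp add: powr_diff)
      finally show ?thesis .
    qed (use M in simp)
  qed
  also have "\<dots> = M / pi * (((t - a) powr \<beta> + (b - t) powr \<beta>) / \<beta>)"
    using g by (rule integral_unique)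
  also have "\<dots> \<le> M / pi * ((\<delta> powr \<beta> + \<delta> powr \<beta>) / \<beta>)"
    using t b M by (intro mult_left_mono divide_right_mono add_mono powr_mono2) auto
  finally show ?thesis by (simp add: field_simps)
qed

text \<open>The class of functions on the half line for which the inversion is uniform. A single constant \<open>M\<close>
  serves for size and increments, so that errors can be measured as multiples of \<open>M\<close>; the decay in
  the Hoelder bound makes the \<open>L\<^sup>1\<close>-modulus of continuity on the half line finite.\<close>
definition decaying_hoelder :: "real \<Rightarrow> real \<Rightarrow> real \<Rightarrow> (real \<Rightarrow> 'a::real_normed_vector) \<Rightarrow> bool" where
  "decaying_hoelder \<beta> \<epsilon> M f \<longleftrightarrow>
     (\<forall>s\<ge>0. norm (f s) \<le> M * exp (- \<epsilon> * s)) \<and>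
     (\<forall>s\<ge>0. \<forall>h\<in>{0..1}. norm (f (s + h) - f s) \<le> M * h powr \<beta> * exp (- \<epsilon> * s))"

context
  fixes \<beta> \<epsilon> M :: real and f :: "real \<Rightarrow> 'a::banach"
  assumes b: "0 < \<beta>" "\<beta> \<le> 1" and e: "0 < \<epsilon>" and dh: "decaying_hoelder \<beta> \<epsilon> M f"
begin

lemma decaying_hoelder_norm: "s \<ge> 0 \<Longrightarrow> norm (f s) \<le> M * exp (- \<epsilon> * s)"
  using dh by (simp add: decaying_hoelder_def)

lemma decaying_hoelder_shift:
  "s \<ge> 0 \<Longrightarrow> 0 \<le> h \<Longrightarrow> h \<le> 1 \<Longrightarrow> norm (f (s + h) - f s) \<le> M * h powr \<beta> * exp (- \<epsilon> * s)"
  using dh by (simp add: decaying_hoelder_def)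

lemma decaying_hoelder_nonneg: "M \<ge> 0"
  using decaying_hoelder_norm[of 0] order_trans[OF norm_ge_zero[of "f 0"], of M] by simp

lemma decaying_hoelder_bound: "s \<ge> 0 \<Longrightarrow> norm (f s) \<le> M"
proof -
  assume s: "s \<ge> 0"
  have "M * exp (- \<epsilon> * s) \<le> M * 1"
    using s e decaying_hoelder_nonneg by (intro mult_left_mono) auto
  then show ?thesis using decaying_hoelder_norm[OF s] by simp
qed

lemma decaying_hoelder_diff:
  assumes "s \<ge> 0" "t \<ge> 0" "\<bar>s - t\<bar> \<le> 1"
  shows "norm (f s - f t) \<le> M * \<bar>s - t\<bar> powr \<beta>"
proof -
  have *: "norm (f r - f q) \<le> M * (r - q) powr \<beta>" if "q \<ge> 0" "q \<le> r" "r - q \<le> 1" for q r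
  proof -
    have "norm (f (q + (r - q)) - f q) \<le> M * (r - q) powr \<beta> * exp (- \<epsilon> * q)"
      by (rule decaying_hoelder_shift) (use that in auto)
    also have "\<dots> \<le> M * (r - q) powr \<beta> * 1"
      using that e decaying_hoelder_nonneg by (intro mult_left_mono) auto
    finally show ?thesis by simp
  qed
  show ?thesis
    using *[of s t] *[of t s] assms by (cases "s \<le> t") (auto simp: norm_minus_commute)
qed

lemma decaying_hoelder_continuous: "continuous_on {0..} f"
  unfolding continuous_on_def
proof
  fix t :: real assume t: "t \<in> {0..}"
  have ev: "\<forall>\<^sub>F s in at t within {0..}. dist s t < 1 \<and> s \<in> {0..}"
    by (auto simp: eventually_at intro!: exI[of _ 1])
  have "((\<lambda>s. M * \<bar>s - t\<bar> powr \<beta>) \<longlongrightarrow> M * 0) (at t within {0..})"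
    by (intro tendsto_mult tendsto_const tendsto_zero_powrI[OF _ tendsto_const])
      (use b in \<open>auto intro!: tendsto_eq_intros\<close>)
  then have lim: "((\<lambda>s. M * \<bar>s - t\<bar> powr \<beta>) \<longlongrightarrow> 0) (at t within {0..})" by simp
  have "\<forall>\<^sub>F s in at t within {0..}. norm (f s - f t) \<le> M * \<bar>s - t\<bar> powr \<beta>"
    using ev
  proof eventually_elim
    case (elim s)
    then show ?case using t by (intro decaying_hoelder_diff) (auto simp: dist_real_def)
  qed
  then have "((\<lambda>s. f s - f t) \<longlongrightarrow> 0) (at t within {0..})"
    by (rule Lim_null_comparison[OF _ lim])
  then show "(f \<longlongrightarrow> f t) (at t within {0..})" by (simp add: LIM_zero_iff)
qed

text \<open>At distance \<open>d\<close> from \<open>t\<close> the kernel is \<open>sin(R(s - t))\<close> times a smooth factor, so the half-period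
  shift applies to \<open>f(s) / (s - t)\<close>. Its increments inherit the decay of those of \<open>f\<close>, which keeps the
  bound independent of the length of the interval.\<close>
lemma norm_integral_sinc_kernel_far:
  assumes R: "R > 0" and h: "h = pi / R" "h \<le> 1" and d: "d > 0" and ab: "0 \<le> a" "a \<le> b"
    and away: "\<And>s. s \<in> {a..b + h} \<Longrightarrow> \<bar>s - t\<bar> \<ge> d"
  shows "norm (integral {a..b} (\<lambda>s. sinc_kernel R (s - t) *\<^sub>R f s))
    \<le> M * h powr \<beta> * ((1 / d + 1 / d\<^sup>2) / \<epsilon> + 2 / d)"
proof -
  define q where "q = (\<lambda>s. (1 / (s - t)) *\<^sub>R f s)"
  have h0: "h > 0" using R h by simp
  have hb: "h \<le> h powr \<beta>"
    using powr_mono'[of \<beta> 1 h] b h(2) h0 by simp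
  note M = decaying_hoelder_nonneg
  have "2 * norm (integral {a..b} (\<lambda>s. sin (R * (s - t)) *\<^sub>R q s))
      \<le> M * h powr \<beta> * (1 / d + 1 / d\<^sup>2) / \<epsilon> + 2 * h * (M / d)"
  proof -
    define J where "J = M * h powr \<beta> * (1 / d + 1 / d\<^sup>2) * ((exp (- \<epsilon> * a) - exp (- \<epsilon> * b)) / \<epsilon>)"
    have "2 * norm (integral {a..b} (\<lambda>s. sin (R * (s - t)) *\<^sub>R q s)) \<le> J + 2 * h * (M / d)"
    proof (rule integral_sin_half_period_shift[OF R h(1) ab(2)])
      have ne: "s - t \<noteq> 0" if "s \<in> {a..b + h}" for s using away[OF that] d by auto
      show "continuous_on {a..b + h} q"
        unfolding q_def using ne ab
        by (intro continuous_intros continuous_on_subset[OF decaying_hoelder_continuous]) auto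
      show "norm (q s) \<le> M / d" if "s \<in> {a..b + h}" for s
      proof -
        have "norm (q s) = norm (f s) / \<bar>s - t\<bar>" by (simp add: q_def)
        also have "\<dots> \<le> M / d"
          using that ab d away[OF that] M by (intro frac_le decaying_hoelder_bound) auto
        finally show ?thesis .
      qed
      show "((\<lambda>s. M * h powr \<beta> * (1 / d + 1 / d\<^sup>2) * exp (- \<epsilon> * s)) has_integral J) {a..b}"
      proof -
        have "((\<lambda>s. - exp (- \<epsilon> * s) / \<epsilon>) has_vector_derivative exp (- \<epsilon> * s)) (at s within {a..b})" for s
          using e unfolding has_real_derivative_iff_has_vector_derivative[symmetric]
          by (auto intro!: derivative_eq_intros)
        then have "((\<lambda>s. exp (- \<epsilon> * s)) has_integral (- exp (- \<epsilon> * b) / \<epsilon> - - exp (- \<epsilon> * a) / \<epsilon>)) {a..b}"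
          by (intro fundamental_theorem_of_calculus ab(2))
        then show ?thesis unfolding J_def
          by (intro has_integral_mult_right) (simp add: diff_divide_distrib)
      qed
      show "norm (q (s + h) - q s) \<le> M * h powr \<beta> * (1 / d + 1 / d\<^sup>2) * exp (- \<epsilon> * s)"
        if s: "s \<in> {a..b}" for s
      proof -
        have s0: "s \<ge> 0" and d1: "\<bar>s - t\<bar> \<ge> d" and d2: "\<bar>s + h - t\<bar> \<ge> d"
          using s ab h0 away[of s] away[of "s + h"] by auto
        have ne2: "s - t \<noteq> 0" "s + h - t \<noteq> 0" using d1 d2 d by auto
        have "1 / x = 1 / y + (y - x) / (y * x)" if "x \<noteq> 0" "y \<noteq> 0" for x y :: real
          using that by (simp add: diff_divide_distrib)
        from this[OF ne2] have "1 / (s - t) = 1 / (s + h - t) + h / ((s + h - t) * (s - t))"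
          by simp
        then have "q (s + h) - q s = (1 / (s + h - t)) *\<^sub>R (f (s + h) - f s)
            - (h / ((s + h - t) * (s - t))) *\<^sub>R f s"
          by (simp add: q_def scaleR_right_diff_distrib scaleR_left_distrib)
        then have "norm (q (s + h) - q s) \<le> norm (f (s + h) - f s) / \<bar>s + h - t\<bar>
            + h * norm (f s) / (\<bar>s + h - t\<bar> * \<bar>s - t\<bar>)"
          using norm_triangle_ineq4[of "(1 / (s + h - t)) *\<^sub>R (f (s + h) - f s)"
              "(h / ((s + h - t) * (s - t))) *\<^sub>R f s"] h0 by (simp add: abs_mult)
        also have "\<dots> \<le> (M * h powr \<beta> * exp (- \<epsilon> * s)) / d + h powr \<beta> * (M * exp (- \<epsilon> * s)) / (d * d)"
          using d d1 d2 h0 h hb M s0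
          by (intro add_mono frac_le mult_mono decaying_hoelder_shift decaying_hoelder_norm) auto
        finally show ?thesis by (simp add: field_simps power2_eq_square)
      qed
    qed
    moreover have "J \<le> M * h powr \<beta> * (1 / d + 1 / d\<^sup>2) * (1 / \<epsilon>)"
    proof -
      have "exp (- \<epsilon> * a) - exp (- \<epsilon> * b) \<le> 1"
        using e ab by (smt (verit) exp_ge_zero exp_le_one_iff mult_nonneg_nonneg mult_minus_left)
      then show ?thesis unfolding J_def
        using M d e by (intro mult_left_mono divide_right_mono) auto
    qed
    ultimately show ?thesis by simp
  qed
  also have "\<dots> \<le> M * h powr \<beta> * (1 / d + 1 / d\<^sup>2) / \<epsilon> + 2 * h powr \<beta> * (M / d)"
    using hb M d by (intro add_left_mono mult_right_mono) auto
  finally have main: "2 * norm (integral {a..b} (\<lambda>s. sin (R * (s - t)) *\<^sub>R q s))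
      \<le> M * h powr \<beta> * ((1 / d + 1 / d\<^sup>2) / \<epsilon> + 2 / d)"
    by (simp add: algebra_simps)
  have "integral {a..b} (\<lambda>s. sinc_kernel R (s - t) *\<^sub>R f s)
      = integral {a..b} (\<lambda>s. (1 / pi) *\<^sub>R (sin (R * (s - t)) *\<^sub>R q s))"
  proof (rule Henstock_Kurzweil_Integration.integral_cong)
    fix s assume "s \<in> {a..b}"
    then have "s - t \<noteq> 0" using away[of s] d h0 by auto
    then show "sinc_kernel R (s - t) *\<^sub>R f s = (1 / pi) *\<^sub>R (sin (R * (s - t)) *\<^sub>R q s)"
      using R by (simp add: sinc_kernel_eq q_def)
  qed
  then have "norm (integral {a..b} (\<lambda>s. sinc_kernel R (s - t) *\<^sub>R f s))
      = norm ((1 / pi) *\<^sub>R integral {a..b} (\<lambda>s. sin (R * (s - t)) *\<^sub>R q s))"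
    unfolding integral_cmul by simp
  also have "\<dots> \<le> 2 * norm (integral {a..b} (\<lambda>s. sin (R * (s - t)) *\<^sub>R q s))"
    unfolding norm_scaleR using pi_gt3 by (intro mult_right_mono) (auto simp: field_simps)
  finally show ?thesis using main by linarith
qed

end

text \<open>The integral splits at \<open>max 0 (t - \<delta>)\<close> and \<open>t + \<delta>\<close>. The two outer parts oscillate. In the
  middle, \<open>f(s) - f(t)\<close> is small, and what remains is \<open>f(t)\<close> times the mass \<open>c\<close> of the kernel. For
  \<open>t \<ge> \<delta>\<close> this mass is close to \<open>1\<close>; for \<open>t < \<delta>\<close> it is merely bounded, but then \<open>f(t)\<close> is small
  because \<open>f(0) = 0\<close>.\<close>
lemma sinc_kernel_integral_approximates:
  fixes f :: "real \<Rightarrow> 'a::banach"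
  assumes b: "0 < \<beta>" "\<beta> \<le> 1" and e: "0 < \<epsilon>" and dh: "decaying_hoelder \<beta> \<epsilon> M f"
    and d: "0 < \<delta>" "\<delta> \<le> 1" and R: "R > 0" "pi / R \<le> \<delta> / 2"
    and B: "\<And>u. \<bar>Si u\<bar> \<le> B"
    and t: "0 \<le> t" "\<delta> \<le> t \<or> f 0 = 0" and N: "t + \<delta> \<le> N"
  shows "norm (integral {0..N} (\<lambda>s. sinc_kernel R (s - t) *\<^sub>R f s) - f t)
    \<le> M * (2 * \<delta> powr \<beta> / (pi * \<beta>) + \<bar>2 * Si (R * \<delta>) / pi - 1\<bar> + (2 * B / pi + 1) * \<delta> powr \<beta>
         + 2 * ((pi / R) powr \<beta> * ((1 / (\<delta> / 2) + 1 / (\<delta> / 2)\<^sup>2) / \<epsilon> + 2 / (\<delta> / 2))))"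
proof -
  define k where "k = (\<lambda>s. sinc_kernel R (s - t) *\<^sub>R f s)"
  define a where "a = max 0 (t - \<delta>)"
  define h where "h = pi / R"
  have h: "0 < h" "h \<le> \<delta> / 2" using R d by (simp_all add: h_def)
  then have h1: "h \<le> 1" using d by linarith
  define far where "far = M * h powr \<beta> * ((1 / (\<delta> / 2) + 1 / (\<delta> / 2)\<^sup>2) / \<epsilon> + 2 / (\<delta> / 2))"
  note M = decaying_hoelder_nonneg[OF b e dh]
  note cont = decaying_hoelder_continuous[OF b e dh]
  have contk: "continuous_on {0..} k" unfolding k_def by (intro continuous_intros cont)
  have int: "k integrable_on {c..d}" if "0 \<le> c" for c d
    by (rule integrable_continuous_real, rule continuous_on_subset[OF contk]) (use that in auto)
  have a0: "0 \<le> a" "a \<le> t" "t - a \<le> \<delta>" using t d by (auto simp: a_def)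
  have far0: "far \<ge> 0" unfolding far_def using M d e by simp
  have left: "norm (integral {0..a} k) \<le> far"
  proof (cases "t \<ge> \<delta>")
    case True
    show ?thesis unfolding k_def far_def
      by (rule norm_integral_sinc_kernel_far[OF b e dh R(1) h_def]) (use True h h1 d a_def in auto)
  next
    case False
    then have "a = 0" by (simp add: a_def)
    then show ?thesis using far0 by simp
  qed
  have right: "norm (integral {t + \<delta>..N} k) \<le> far"
    unfolding k_def far_def
    by (rule norm_integral_sinc_kernel_far[OF b e dh R(1) h_def]) (use h h1 d N t in auto)
  define c where "c = (Si (R * (t + \<delta> - t)) - Si (R * (a - t))) / pi"
  have near: "norm (integral {a..t + \<delta>} (\<lambda>s. sinc_kernel R (s - t) *\<^sub>R (f s - f t))) \<le> 2 * M * \<delta> powr \<beta> / (pi * \<beta>)"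
    by (rule norm_integral_sinc_kernel_near[OF R(1) b(1) d(1) M])
      (use a0 d t in \<open>auto intro!: decaying_hoelder_diff[OF b e dh] continuous_on_subset[OF cont]\<close>)
  have hk: "((\<lambda>s. sinc_kernel R (s - t)) has_integral c) {a..t + \<delta>}"
    unfolding c_def by (rule has_integral_sinc_kernel) (use a0 d in auto)
  have middle: "integral {a..t + \<delta>} k
      = integral {a..t + \<delta>} (\<lambda>s. sinc_kernel R (s - t) *\<^sub>R (f s - f t)) + c *\<^sub>R f t"
  proof -
    have i1: "((\<lambda>s. sinc_kernel R (s - t) *\<^sub>R f t) has_integral c *\<^sub>R f t) {a..t + \<delta>}"
      using has_integral_linear[OF hk bounded_linear_scaleR_left[of "f t"]] by (simp add: o_def)
    have i2: "(k has_integral integral {a..t + \<delta>} k) {a..t + \<delta>}"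
      using int[OF a0(1)] by (rule integrable_integral)
    have "((\<lambda>s. sinc_kernel R (s - t) *\<^sub>R (f s - f t)) has_integral (integral {a..t + \<delta>} k - c *\<^sub>R f t)) {a..t + \<delta>}"
      using has_integral_diff[OF i2 i1] by (simp add: k_def scaleR_right_diff_distrib)
    then show ?thesis by (simp add: integral_unique)
  qed
  have delta: "norm ((c - 1) *\<^sub>R f t) \<le> M * \<bar>2 * Si (R * \<delta>) / pi - 1\<bar> + M * ((2 * B / pi + 1) * \<delta> powr \<beta>)"
  proof -
    have B0: "B \<ge> 0" using B[of 0] by linarith
    show ?thesis
    proof (cases "t \<ge> \<delta>")
      case True
      then have "a - t = - \<delta>" by (simp add: a_def)
      then have c: "c = 2 * Si (R * \<delta>) / pi"
        using Si_neg[of "R * \<delta>"] R d by (simp add: c_def)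
      have "norm ((c - 1) *\<^sub>R f t) \<le> \<bar>c - 1\<bar> * M"
        unfolding norm_scaleR by (intro mult_left_mono decaying_hoelder_bound[OF b e dh] t) auto
      moreover have "0 \<le> M * ((2 * B / pi + 1) * \<delta> powr \<beta>)" using M B0 by simp
      ultimately show ?thesis by (simp add: c mult.commute)
    next
      case False
      then have f0: "f 0 = 0" using t by simp
      have "norm (f t) \<le> M * t powr \<beta>"
        using decaying_hoelder_diff[OF b e dh t(1), of 0] False t d f0 by simp
      also have "\<dots> \<le> M * \<delta> powr \<beta>"
        using False t b M by (intro mult_left_mono powr_mono2) auto
      finally have ft: "norm (f t) \<le> M * \<delta> powr \<beta>" .
      have "\<bar>c\<bar> \<le> (B + B) / pi"
        unfolding c_def abs_divide using B[of "R * (t + \<delta> - t)"] B[of "R * (a - t)"]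
        by (simp add: divide_right_mono)
      then have "\<bar>c - 1\<bar> \<le> 2 * B / pi + 1" by simp
      then have "norm ((c - 1) *\<^sub>R f t) \<le> (2 * B / pi + 1) * (M * \<delta> powr \<beta>)"
        unfolding norm_scaleR using ft M B0 by (intro mult_mono) auto
      moreover have "0 \<le> M * \<bar>2 * Si (R * \<delta>) / pi - 1\<bar>" using M by simp
      ultimately show ?thesis by (simp add: algebra_simps)
    qed
  qed
  have "integral {0..N} k = integral {0..a} k + integral {a..t + \<delta>} k + integral {t + \<delta>..N} k"
    using Henstock_Kurzweil_Integration.integral_combine[of 0 a "t + \<delta>" k]
      Henstock_Kurzweil_Integration.integral_combine[of 0 "t + \<delta>" N k] int a0 d t N by simp
  then have "integral {0..N} k - f t = integral {0..a} k + integral {t + \<delta>..N} k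
      + integral {a..t + \<delta>} (\<lambda>s. sinc_kernel R (s - t) *\<^sub>R (f s - f t)) + (c - 1) *\<^sub>R f t"
    unfolding middle scaleR_left_diff_distrib scaleR_one by (simp only: add_ac diff_conv_add_uminus)
  then have "norm (integral {0..N} k - f t) \<le> norm (integral {0..a} k) + norm (integral {t + \<delta>..N} k)
      + norm (integral {a..t + \<delta>} (\<lambda>s. sinc_kernel R (s - t) *\<^sub>R (f s - f t))) + norm ((c - 1) *\<^sub>R f t)"
    by (simp only:) (intro norm_triangle_mono order_refl)
  also have "\<dots> \<le> far + far + 2 * M * \<delta> powr \<beta> / (pi * \<beta>)
      + (M * \<bar>2 * Si (R * \<delta>) / pi - 1\<bar> + M * ((2 * B / pi + 1) * \<delta> powr \<beta>))"
    by (intro add_mono left right near delta)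
  finally show ?thesis
    unfolding k_def far_def h_def[symmetric] by (simp add: algebra_simps)
qed

lemma truncated_fourier_inversion:
  fixes f :: "real \<Rightarrow> 'a::cbanach"
  assumes cont: "continuous_on {0..N} f" and R: "R > 0"
  shows "(\<lambda>\<eta>. cis (\<eta> * t) *\<^sub>C integral {0..N} (\<lambda>s. cis (- \<eta> * s) *\<^sub>C f s)) integrable_on {- R..R}"
    and "integral {- R..R} (\<lambda>\<eta>. cis (\<eta> * t) *\<^sub>C integral {0..N} (\<lambda>s. cis (- \<eta> * s) *\<^sub>C f s))
      = (2 * pi) *\<^sub>R integral {0..N} (\<lambda>s. sinc_kernel R (s - t) *\<^sub>R f s)"
proof -
  define g where "g = (\<lambda>\<eta> s. cis (\<eta> * (t - s)) *\<^sub>C f s)"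
  have inner: "cis (\<eta> * t) *\<^sub>C integral {0..N} (\<lambda>s. cis (- \<eta> * s) *\<^sub>C f s) = integral {0..N} (g \<eta>)" for \<eta>
  proof -
    have "(\<lambda>s. cis (- \<eta> * s) *\<^sub>C f s) integrable_on {0..N}"
      by (intro integrable_continuous_real continuous_intros cont continuous_on_cis)
    from integral_linear[OF this bounded_linear_scaleC_right[of "cis (\<eta> * t)"]] show ?thesis
      by (simp add: o_def g_def scaleC_scaleC cis_mult algebra_simps)
  qed
  have contg: "continuous_on (cbox (- R, 0) (R, N)) (\<lambda>(\<eta>, s). g \<eta> s)"
    unfolding g_def case_prod_unfold
    by (intro continuous_intros continuous_on_cis continuous_on_compose2[OF cont]) auto
  show "(\<lambda>\<eta>. cis (\<eta> * t) *\<^sub>C integral {0..N} (\<lambda>s. cis (- \<eta> * s) *\<^sub>C f s)) integrable_on {- R..R}"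
    unfolding inner using integral_integrable_2dim[OF contg] by simp
  have outer: "integral {- R..R} (\<lambda>\<eta>. g \<eta> s) = (2 * pi) *\<^sub>R (sinc_kernel R (s - t) *\<^sub>R f s)" for s
  proof -
    have "sinc_kernel R (t - s) = sinc_kernel R (s - t)"
      using sinc_kernel_minus[of R "s - t"] by simp
    moreover have "((\<lambda>\<eta>. g \<eta> s) has_integral of_real (2 * pi * sinc_kernel R (t - s)) *\<^sub>C f s) {- R..R}"
      using has_integral_linear[OF has_integral_cis_sinc_kernel[OF R] bounded_linear_scaleC_left[of "f s"], of "t - s"]
      by (simp add: o_def g_def)
    ultimately show ?thesis unfolding scaleC_of_real by (simp add: integral_unique)
  qed
  have "integral {- R..R} (\<lambda>\<eta>. integral {0..N} (g \<eta>)) = integral {0..N} (\<lambda>s. integral {- R..R} (\<lambda>\<eta>. g \<eta> s))"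
    using integral_swap_continuous[OF contg] by simp
  also have "\<dots> = (2 * pi) *\<^sub>R integral {0..N} (\<lambda>s. sinc_kernel R (s - t) *\<^sub>R f s)"
    unfolding outer by (rule integral_cmul)
  finally show "integral {- R..R} (\<lambda>\<eta>. cis (\<eta> * t) *\<^sub>C integral {0..N} (\<lambda>s. cis (- \<eta> * s) *\<^sub>C f s))
      = (2 * pi) *\<^sub>R integral {0..N} (\<lambda>s. sinc_kernel R (s - t) *\<^sub>R f s)"
    unfolding inner .
qed

text \<open>For fixed \<open>R\<close>, replacing the transform by its truncation at \<open>N\<close> costs at most \<open>2R\<close> times the
  tail bound. Letting \<open>N\<close> tend to infinity afterwards means that the order of integration is
  exchanged on compact rectangles only, where all integrands are continuous.\<close>
lemma fourier_inversion_as_limit: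
  fixes f F :: "real \<Rightarrow> 'a::cbanach"
  assumes cont: "continuous_on {0..} f" and R: "R > 0" and e: "\<epsilon> > 0" and M: "M \<ge> 0"
    and tail: "\<And>\<eta> N. N \<ge> 0 \<Longrightarrow> norm (F \<eta> - integral {0..N} (\<lambda>s. cis (- \<eta> * s) *\<^sub>C f s)) \<le> M * exp (- \<epsilon> * N) / \<epsilon>"
  shows "(\<lambda>\<eta>. cis (\<eta> * t) *\<^sub>C F \<eta>) integrable_on {- R..R}"
    and "((\<lambda>N. integral {0..N} (\<lambda>s. sinc_kernel R (s - t) *\<^sub>R f s))
      \<longlongrightarrow> (1 / (2 * pi)) *\<^sub>R integral {- R..R} (\<lambda>\<eta>. cis (\<eta> * t) *\<^sub>C F \<eta>)) at_top"
proof -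
  define G where "G = (\<lambda>N \<eta>. cis (\<eta> * t) *\<^sub>C integral {0..N} (\<lambda>s. cis (- \<eta> * s) *\<^sub>C f s))"
  have cN: "continuous_on {0..N} f" for N by (rule continuous_on_subset[OF cont]) auto
  have lim0: "((\<lambda>N. c * exp (- \<epsilon> * N) / \<epsilon>) \<longlongrightarrow> 0) at_top" for c
    using tendsto_mult_right_zero[OF tendsto_exp_neg_mult_at_top[OF e], of "c / \<epsilon>"] by simp
  have Gd: "norm (cis (\<eta> * t) *\<^sub>C F \<eta> - G N \<eta>) \<le> M * exp (- \<epsilon> * N) / \<epsilon>" if "N \<ge> 0" for N \<eta>
    using tail[OF that] by (simp add: G_def scaleC_diff_right[symmetric] norm_scaleC)
  have Gi: "G N integrable_on {- R..R}" for N
    unfolding G_def by (rule truncated_fourier_inversion(1)[OF cN R])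
  show int: "(\<lambda>\<eta>. cis (\<eta> * t) *\<^sub>C F \<eta>) integrable_on {- R..R}"
  proof -
    have "\<exists>g. (\<forall>\<eta>\<in>cbox (- R) R. norm (cis (\<eta> * t) *\<^sub>C F \<eta> - g \<eta>) \<le> r) \<and> g integrable_on cbox (- R) R"
      if "r > 0" for r
    proof -
      have "\<forall>\<^sub>F N in at_top. M * exp (- \<epsilon> * N) / \<epsilon> < r \<and> N \<ge> 0"
        using order_tendstoD(2)[OF lim0 that] eventually_ge_at_top[of 0] by (rule eventually_conj)
      then obtain N where "M * exp (- \<epsilon> * N) / \<epsilon> < r" "N \<ge> 0"
        by (auto dest: eventually_happens)
      then show ?thesis using Gd[of N] Gi[of N] by (intro exI[of _ "G N"]) (auto intro: order_trans less_imp_le)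
    qed
    then show ?thesis using integrable_uniform_limit[of "- R" R "\<lambda>\<eta>. cis (\<eta> * t) *\<^sub>C F \<eta>"] by simp
  qed
  have "((\<lambda>N. integral {- R..R} (G N)) \<longlongrightarrow> integral {- R..R} (\<lambda>\<eta>. cis (\<eta> * t) *\<^sub>C F \<eta>)) at_top"
  proof (rule LIM_zero_cancel, rule Lim_null_comparison[OF _ lim0[of "2 * R * M"]])
    show "\<forall>\<^sub>F N in at_top. norm (integral {- R..R} (G N) - integral {- R..R} (\<lambda>\<eta>. cis (\<eta> * t) *\<^sub>C F \<eta>))
        \<le> 2 * R * M * exp (- \<epsilon> * N) / \<epsilon>"
      using eventually_ge_at_top[of 0]
    proof eventually_elim
      case (elim N)
      have "((\<lambda>\<eta>. G N \<eta> - cis (\<eta> * t) *\<^sub>C F \<eta>) has_integral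
          (integral {- R..R} (G N) - integral {- R..R} (\<lambda>\<eta>. cis (\<eta> * t) *\<^sub>C F \<eta>))) {- R..R}"
        by (intro has_integral_diff integrable_integral Gi int)
      then have "norm (integral {- R..R} (G N) - integral {- R..R} (\<lambda>\<eta>. cis (\<eta> * t) *\<^sub>C F \<eta>))
          \<le> (M * exp (- \<epsilon> * N) / \<epsilon>) * measure lborel {- R..R}"
        by (rule has_integral_bound_real[rotated 2])
          (use M e elim Gd[of N] in \<open>auto simp: norm_minus_commute\<close>)
      then show ?case using R by (simp add: mult_ac)
    qed
  qed
  from tendsto_scaleR[OF tendsto_const[of "1 / (2 * pi)"] this]
  show "((\<lambda>N. integral {0..N} (\<lambda>s. sinc_kernel R (s - t) *\<^sub>R f s))
      \<longlongrightarrow> (1 / (2 * pi)) *\<^sub>R integral {- R..R} (\<lambda>\<eta>. cis (\<eta> * t) *\<^sub>C F \<eta>)) at_top"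
    unfolding G_def truncated_fourier_inversion(2)[OF cN R] by simp
qed

text \<open>The quantifiers matter: \<open>R\<close> is chosen before the function, its transform and the point. The
  transform \<open>F\<close> enters only through its distance to the truncated Fourier integrals, which also
  identifies it. First \<open>\<delta>\<close> is chosen to make the terms with \<open>\<delta>\<^sup>\<beta>\<close> small, then \<open>R\<close> to
  make the others small.\<close>
theorem uniform_fourier_inversion:
  fixes \<beta> \<epsilon> \<tau> e :: real
  assumes b: "0 < \<beta>" "\<beta> \<le> 1" and ep: "0 < \<epsilon>" and tau: "0 < \<tau>" and e: "0 < e"
  shows "\<forall>\<^sub>F R in at_top. \<forall>M f F t. decaying_hoelder \<beta> \<epsilon> M (f :: real \<Rightarrow> 'a::cbanach) \<longrightarrow>
    (\<forall>\<eta>. \<forall>N\<ge>0. norm (F \<eta> - integral {0..N} (\<lambda>s. cis (- \<eta> * s) *\<^sub>C f s)) \<le> M * exp (- \<epsilon> * N) / \<epsilon>) \<longrightarrow>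
    0 \<le> t \<longrightarrow> \<tau> \<le> t \<or> f 0 = 0 \<longrightarrow>
    norm ((1 / (2 * pi)) *\<^sub>R integral {- R..R} (\<lambda>\<eta>. cis (\<eta> * t) *\<^sub>C F \<eta>) - f t) \<le> e * M"
proof -
  obtain B where B: "\<And>u. \<bar>Si u\<bar> \<le> B" using bounded_Si by auto
  have "((\<lambda>\<delta>. (2 / (pi * \<beta>) + (2 * B / pi + 1)) * \<delta> powr \<beta>) \<longlongrightarrow> (2 / (pi * \<beta>) + (2 * B / pi + 1)) * 0) (at_right 0)"
    by (intro tendsto_mult tendsto_const tendsto_zero_powrI[OF _ tendsto_const])
      (use b in \<open>auto simp: eventually_at_filter\<close>)
  then have "\<forall>\<^sub>F \<delta> in at_right 0. (2 / (pi * \<beta>) + (2 * B / pi + 1)) * \<delta> powr \<beta> < e / 3"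
    by (rule order_tendstoD) (use e in simp)
  moreover have "\<forall>\<^sub>F \<delta> in at_right (0::real). 0 < \<delta> \<and> \<delta> < min 1 \<tau>"
    using tau by (simp add: eventually_at_right) (auto intro!: exI[of _ "min 1 \<tau>"])
  ultimately have "\<forall>\<^sub>F \<delta> in at_right (0::real). (2 / (pi * \<beta>) + (2 * B / pi + 1)) * \<delta> powr \<beta> < e / 3 \<and> 0 < \<delta> \<and> \<delta> < min 1 \<tau>"
    by (rule eventually_conj)
  then obtain \<delta> where small: "(2 / (pi * \<beta>) + (2 * B / pi + 1)) * \<delta> powr \<beta> < e / 3" and d: "0 < \<delta>" "\<delta> < 1" "\<delta> < \<tau>"
    by (auto dest!: eventually_happens)
  define K where "K = (1 / (\<delta> / 2) + 1 / (\<delta> / 2)\<^sup>2) / \<epsilon> + 2 / (\<delta> / 2)"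
  have piR: "((\<lambda>R. pi / R) \<longlongrightarrow> 0) at_top"
    by (intro tendsto_divide_0[OF tendsto_const] filterlim_at_top_imp_at_infinity filterlim_ident)
  have "((\<lambda>R. 2 * ((pi / R) powr \<beta> * K)) \<longlongrightarrow> 2 * (0 * K)) at_top"
    by (intro tendsto_mult tendsto_const tendsto_zero_powrI[OF piR tendsto_const])
      (use b in \<open>auto intro!: eventually_mono[OF eventually_gt_at_top[of 0]]\<close>)
  then have ev1: "\<forall>\<^sub>F R in at_top. 2 * ((pi / R) powr \<beta> * K) < e / 3"
    by (rule order_tendstoD) (use e in simp)
  have "((\<lambda>R. \<bar>2 * Si (R * \<delta>) / pi - 1\<bar>) \<longlongrightarrow> \<bar>2 * (pi / 2) / pi - 1\<bar>) at_top"
    by (intro tendsto_intros filterlim_compose[OF Si_at_top] filterlim_at_top_mult_tendsto_pos[OF tendsto_const _ filterlim_ident])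
      (use d in auto)
  then have ev2: "\<forall>\<^sub>F R in at_top. \<bar>2 * Si (R * \<delta>) / pi - 1\<bar> < e / 3"
    by (rule order_tendstoD) (use e in simp)
  have ev3: "\<forall>\<^sub>F R in at_top. pi / R < \<delta> / 2"
    by (rule order_tendstoD(2)[OF piR]) (use d in simp)
  show ?thesis
    using ev1 ev2 ev3 eventually_gt_at_top[of 0]
  proof eventually_elim
    case (elim R)
    show ?case
    proof (intro allI impI)
      fix M t and f F :: "real \<Rightarrow> 'a"
      assume dh: "decaying_hoelder \<beta> \<epsilon> M f" and t: "0 \<le> t" "\<tau> \<le> t \<or> f 0 = 0"
        and tail: "\<forall>\<eta>. \<forall>N\<ge>0. norm (F \<eta> - integral {0..N} (\<lambda>s. cis (- \<eta> * s) *\<^sub>C f s)) \<le> M * exp (- \<epsilon> * N) / \<epsilon>"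
      note M = decaying_hoelder_nonneg[OF b ep dh]
      have "((\<lambda>N. integral {0..N} (\<lambda>s. sinc_kernel R (s - t) *\<^sub>R f s))
          \<longlongrightarrow> (1 / (2 * pi)) *\<^sub>R integral {- R..R} (\<lambda>\<eta>. cis (\<eta> * t) *\<^sub>C F \<eta>)) at_top"
        by (rule fourier_inversion_as_limit(2)[OF decaying_hoelder_continuous[OF b ep dh] elim(4) ep M])
          (use tail in blast)
      then have lim: "((\<lambda>N. norm (integral {0..N} (\<lambda>s. sinc_kernel R (s - t) *\<^sub>R f s) - f t))
          \<longlongrightarrow> norm ((1 / (2 * pi)) *\<^sub>R integral {- R..R} (\<lambda>\<eta>. cis (\<eta> * t) *\<^sub>C F \<eta>) - f t)) at_top"
        by (intro tendsto_intros)
      have "\<forall>\<^sub>F N in at_top. norm (integral {0..N} (\<lambda>s. sinc_kernel R (s - t) *\<^sub>R f s) - f t) \<le> e * M"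
        using eventually_ge_at_top[of "t + \<delta>"]
      proof eventually_elim
        case N: (elim N)
        have "norm (integral {0..N} (\<lambda>s. sinc_kernel R (s - t) *\<^sub>R f s) - f t)
          \<le> M * (2 * \<delta> powr \<beta> / (pi * \<beta>) + \<bar>2 * Si (R * \<delta>) / pi - 1\<bar> + (2 * B / pi + 1) * \<delta> powr \<beta>
              + 2 * ((pi / R) powr \<beta> * K))"
          unfolding K_def
          by (rule sinc_kernel_integral_approximates[OF b ep dh]) (use d elim t N B in auto)
        also have "\<dots> \<le> M * e"
        proof (rule mult_left_mono[OF _ M])
          have "2 * \<delta> powr \<beta> / (pi * \<beta>) + (2 * B / pi + 1) * \<delta> powr \<beta> = (2 / (pi * \<beta>) + (2 * B / pi + 1)) * \<delta> powr \<beta>"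
            by (simp add: algebra_simps)
          then show "2 * \<delta> powr \<beta> / (pi * \<beta>) + \<bar>2 * Si (R * \<delta>) / pi - 1\<bar> + (2 * B / pi + 1) * \<delta> powr \<beta>
              + 2 * ((pi / R) powr \<beta> * K) \<le> e"
            using small elim by linarith
        qed
        finally show ?case by (simp add: mult.commute)
      qed
      then show "norm ((1 / (2 * pi)) *\<^sub>R integral {- R..R} (\<lambda>\<eta>. cis (\<eta> * t) *\<^sub>C F \<eta>) - f t) \<le> e * M"
        by (intro tendsto_upperbound[OF lim]) auto
    qed
  qed
qed

section \<open>The resolvent as a Laplace transform\<close>

lemma right_difference_quotient_tendsto:
  fixes f :: "real \<Rightarrow> 'a::real_normed_vector"
  assumes "(f has_vector_derivative d) (at 0 within {0..1})"
  shows "((\<lambda>h. (1 / h) *\<^sub>R (f h - f 0)) \<longlongrightarrow> d) (at_right 0)"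
proof -
  have "((\<lambda>h. norm (f h - f 0 - h *\<^sub>R d) / \<bar>h\<bar>) \<longlongrightarrow> 0) (at_right 0)"
    using assms by (simp add: has_vector_derivative_def has_derivative_iff_norm at_within_Icc_at_right)
  then have "((\<lambda>h. norm ((1 / h) *\<^sub>R (f h - f 0) - d)) \<longlongrightarrow> 0) (at_right 0)"
  proof (rule Lim_transform_eventually)
    show "\<forall>\<^sub>F h in at_right 0. norm (f h - f 0 - h *\<^sub>R d) / \<bar>h\<bar> = norm ((1 / h) *\<^sub>R (f h - f 0) - d)"
      using eventually_at_right_less[of 0]
    proof eventually_elim
      case (elim h)
      then have "(1 / h) *\<^sub>R (f h - f 0) - d = (1 / h) *\<^sub>R (f h - f 0 - h *\<^sub>R d)"
        by (simp add: scaleR_diff_right)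
      then show ?case using elim by simp
    qed
  qed
  then show ?thesis by (simp add: tendsto_norm_zero_iff LIM_zero_iff)
qed

text \<open>The constant \<open>C\<close> is fixed here because the thresholds below must depend on \<open>S\<close>
  through \<open>C\<close> and \<open>\<omega>\<^sub>0\<close> only, never through a vector.\<close>
locale decaying_semigroup =
  fixes S :: "real \<Rightarrow> 'a::cbanach \<Rightarrow> 'a" and \<omega>\<^sub>0 C :: real
  assumes C0: "C0_semigroup S"
    and neg: "\<omega>\<^sub>0 < 0"
    and C_pos: "C > 0"
    and bound: "\<And>t y. t \<ge> 0 \<Longrightarrow> norm (S t y) \<le> C * exp (\<omega>\<^sub>0 * t) * norm y"
begin

lemma S_linear: "t \<ge> 0 \<Longrightarrow> bounded_linear (S t)"
  using C0 by (simp add: C0_semigroup_def bounded_clinear_def)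

lemma S_scaleC: "t \<ge> 0 \<Longrightarrow> S t (c *\<^sub>C y) = c *\<^sub>C S t y"
  using C0 by (simp add: C0_semigroup_def bounded_clinear_def)

lemma S_0 [simp]: "S 0 y = y"
  using C0 by (simp add: C0_semigroup_def)

lemma S_add: "s \<ge> 0 \<Longrightarrow> t \<ge> 0 \<Longrightarrow> S (s + t) y = S s (S t y)"
  using C0 by (simp add: C0_semigroup_def)

lemma S_diff: "t \<ge> 0 \<Longrightarrow> S t (x - y) = S t x - S t y"
  by (rule linear_diff[OF bounded_linear.linear[OF S_linear]])

lemma S_commute: "s \<ge> 0 \<Longrightarrow> t \<ge> 0 \<Longrightarrow> S s (S t y) = S t (S s y)"
  by (metis S_add add.commute)

lemma norm_S_le: "t \<ge> 0 \<Longrightarrow> norm (S t y) \<le> C * norm y"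
proof -
  assume t: "t \<ge> 0"
  have "C * exp (\<omega>\<^sub>0 * t) * norm y \<le> C * 1 * norm y"
    using t neg C_pos by (intro mult_right_mono mult_left_mono) (auto simp: mult_nonpos_nonneg)
  then show ?thesis using bound[OF t, of y] by simp
qed

lemma orbit_continuous: "continuous_on {0..} (\<lambda>t. S t y)"
  unfolding continuous_on_def
proof
  fix t :: real assume t: "t \<in> {0..}"
  \<comment> \<open>Two-sided continuity at \<open>t\<close> reduces to right continuity at \<open>0\<close> by factoring out the earlier
    time, as the semigroup is uniformly bounded.\<close>
  have incr: "norm (S r y - S q y) \<le> C * norm (S (r - q) y - y)" if "0 \<le> q" "q \<le> r" for q r
  proof -
    have "S r y - S q y = S q (S (r - q) y - y)"
      using that S_add[of q "r - q" y] by (simp add: S_diff)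
    then show ?thesis using norm_S_le[OF that(1)] by simp
  qed
  have bnd: "norm (S s y - S t y) \<le> C * norm (S \<bar>s - t\<bar> y - y)" if "s \<ge> 0" for s
    using incr[of s t] incr[of t s] that t by (cases "s \<le> t") (auto simp: norm_minus_commute)
  have at0: "((\<lambda>u. S u y) \<longlongrightarrow> y) (at_right 0)"
    using C0 by (simp add: C0_semigroup_def)
  have within: "((\<lambda>u. S u y) \<longlongrightarrow> S 0 y) (at 0 within {0..})"
    using at0 by (simp add: at_within_Ici_at_right)
  have "((\<lambda>s. S \<bar>s - t\<bar> y) \<longlongrightarrow> S 0 y) (at t within {0..})"
  proof (rule continuous_within_tendsto_compose[of 0 "{0..}" "\<lambda>u. S u y"])
    show "continuous (at 0 within {0..}) (\<lambda>u. S u y)"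
      using within by (simp add: continuous_within)
    show "((\<lambda>s. \<bar>s - t\<bar>) \<longlongrightarrow> 0) (at t within {0..})"
      by (auto intro!: tendsto_eq_intros)
  qed auto
  then have "((\<lambda>s. C * norm (S \<bar>s - t\<bar> y - y)) \<longlongrightarrow> C * norm (S 0 y - y)) (at t within {0..})"
    by (intro tendsto_intros)
  then have lim: "((\<lambda>s. C * norm (S \<bar>s - t\<bar> y - y)) \<longlongrightarrow> 0) (at t within {0..})"
    by simp
  have "\<forall>\<^sub>F s in at t within {0..}. norm (S s y - S t y) \<le> C * norm (S \<bar>s - t\<bar> y - y)"
    by (auto simp: eventually_at_filter intro!: always_eventually bnd)
  then have "((\<lambda>s. S s y - S t y) \<longlongrightarrow> 0) (at t within {0..})"
    by (rule Lim_null_comparison[OF _ lim])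
  then show "((\<lambda>s. S s y) \<longlongrightarrow> S t y) (at t within {0..})" by (simp add: LIM_zero_iff)
qed

definition laplace :: "complex \<Rightarrow> 'a \<Rightarrow> 'a" where
  "laplace z y = Lim at_top (\<lambda>N. integral {0..N} (\<lambda>s. exp (- z * of_real s) *\<^sub>C S s y))"

lemma continuous_on_laplace_integrand: "continuous_on {0..} (\<lambda>s. exp (- z * of_real s) *\<^sub>C S s y)"
  by (intro continuous_intros orbit_continuous)

lemma integrable_laplace_integrand:
  "a \<ge> 0 \<Longrightarrow> (\<lambda>s. exp (- z * of_real s) *\<^sub>C S s y) integrable_on {a..b}"
  by (intro integrable_continuous_real continuous_on_subset[OF continuous_on_laplace_integrand]) auto

lemma
  assumes "Re z > \<omega>\<^sub>0"
  shows laplace_tendsto: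
      "((\<lambda>N. integral {0..N} (\<lambda>s. exp (- z * of_real s) *\<^sub>C S s y)) \<longlongrightarrow> laplace z y) at_top"
    and norm_laplace_le: "norm (laplace z y) \<le> norm y * (C / (Re z - \<omega>\<^sub>0))"
proof -
  have b: "norm (exp (- z * of_real s) *\<^sub>C S s y) \<le> (C * norm y) * exp (- (Re z - \<omega>\<^sub>0) * s)" if "s \<ge> 0" for s
  proof -
    have "norm (exp (- z * of_real s) *\<^sub>C S s y) \<le> exp (- Re z * s) * (C * exp (\<omega>\<^sub>0 * s) * norm y)"
      unfolding norm_scaleC using bound[OF that, of y] by (intro mult_mono) auto
    also have "\<dots> = (C * norm y) * exp (- (Re z - \<omega>\<^sub>0) * s)"
    proof -
      have "exp (- (Re z - \<omega>\<^sub>0) * s) = exp (- Re z * s) * exp (\<omega>\<^sub>0 * s)"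
        by (simp add: exp_add[symmetric] algebra_simps)
      then show ?thesis by simp
    qed
    finally show ?thesis .
  qed
  obtain F where F: "((\<lambda>N. integral {0..N} (\<lambda>s. exp (- z * of_real s) *\<^sub>C S s y)) \<longlongrightarrow> F) at_top"
    and tail: "\<And>N. N \<ge> 0 \<Longrightarrow> norm (F - integral {0..N} (\<lambda>s. exp (- z * of_real s) *\<^sub>C S s y))
      \<le> (C * norm y) * exp (- (Re z - \<omega>\<^sub>0) * N) / (Re z - \<omega>\<^sub>0)"
  proof (rule improper_integral_exp_tail[OF continuous_on_laplace_integrand _ _ b])
    show "Re z - \<omega>\<^sub>0 > 0" "C * norm y \<ge> 0" using assms C_pos by simp_all
  qed (assumption | blast)+
  have eq: "laplace z y = F" unfolding laplace_def using F by (intro tendsto_Lim) auto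
  show "((\<lambda>N. integral {0..N} (\<lambda>s. exp (- z * of_real s) *\<^sub>C S s y)) \<longlongrightarrow> laplace z y) at_top"
    using F eq by simp
  show "norm (laplace z y) \<le> norm y * (C / (Re z - \<omega>\<^sub>0))"
    using tail[of 0] eq by (simp add: mult_ac)
qed

lemma bounded_linear_laplace:
  assumes z: "Re z > \<omega>\<^sub>0"
  shows "bounded_linear (laplace z)"
proof (rule bounded_linear_intro)
  fix x y :: 'a and r :: real
  have add: "S s (x + y) = S s x + S s y" and scale: "S s (r *\<^sub>R x) = r *\<^sub>R S s x" if "s \<ge> 0" for s
    using bounded_linear.linear[OF S_linear[OF that]] by (simp_all add: linear_add linear_scale)
  have "integral {0..N} (\<lambda>s. exp (- z * of_real s) *\<^sub>C S s (x + y))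
      = integral {0..N} (\<lambda>s. exp (- z * of_real s) *\<^sub>C S s x) + integral {0..N} (\<lambda>s. exp (- z * of_real s) *\<^sub>C S s y)" for N
  proof -
    have "integral {0..N} (\<lambda>s. exp (- z * of_real s) *\<^sub>C S s (x + y))
        = integral {0..N} (\<lambda>s. exp (- z * of_real s) *\<^sub>C S s x + exp (- z * of_real s) *\<^sub>C S s y)"
      by (rule Henstock_Kurzweil_Integration.integral_cong) (simp add: add scaleC_add_right)
    then show ?thesis
      unfolding Henstock_Kurzweil_Integration.integral_add[OF integrable_laplace_integrand[OF order_refl]
          integrable_laplace_integrand[OF order_refl]] .
  qed
  with tendsto_add[OF laplace_tendsto[OF z, of x] laplace_tendsto[OF z, of y]]
  show "laplace z (x + y) = laplace z x + laplace z y"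
    using tendsto_unique[OF _ laplace_tendsto[OF z]] by simp
  have "integral {0..N} (\<lambda>s. exp (- z * of_real s) *\<^sub>C S s (r *\<^sub>R x))
      = r *\<^sub>R integral {0..N} (\<lambda>s. exp (- z * of_real s) *\<^sub>C S s x)" for N
    by (subst integral_cmul[symmetric])
      (auto intro!: Henstock_Kurzweil_Integration.integral_cong simp: scale scaleC_scaleR scaleR_scaleC mult.commute)
  with tendsto_scaleR[OF tendsto_const laplace_tendsto[OF z, of x], of r]
  show "laplace z (r *\<^sub>R x) = r *\<^sub>R laplace z x"
    using tendsto_unique[OF _ laplace_tendsto[OF z]] by simp
  show "norm (laplace z x) \<le> norm x * (C / (Re z - \<omega>\<^sub>0))"
    by (rule norm_laplace_le[OF z])
qed

text \<open>A bounded complex-linear operator can be moved under the integral. Applied to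
  \<open>S h\<close>, to complex scalars and to the difference operator \<open>S h - 1\<close>.\<close>
lemma laplace_intertwines:
  assumes z: "Re z > \<omega>\<^sub>0" and T: "bounded_linear T"
    and comm: "\<And>s. s \<ge> 0 \<Longrightarrow> S s (T y) = T (S s y)"
    and scale: "\<And>c x. T (c *\<^sub>C x) = c *\<^sub>C T x"
  shows "laplace z (T y) = T (laplace z y)"
proof -
  have "integral {0..N} (\<lambda>s. exp (- z * of_real s) *\<^sub>C S s (T y))
      = T (integral {0..N} (\<lambda>s. exp (- z * of_real s) *\<^sub>C S s y))" for N
  proof -
    have "integral {0..N} (\<lambda>s. exp (- z * of_real s) *\<^sub>C S s (T y))
        = integral {0..N} (T \<circ> (\<lambda>s. exp (- z * of_real s) *\<^sub>C S s y))"
      by (rule Henstock_Kurzweil_Integration.integral_cong) (simp add: comm scale)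
    also have "\<dots> = T (integral {0..N} (\<lambda>s. exp (- z * of_real s) *\<^sub>C S s y))"
      by (rule integral_linear[OF integrable_laplace_integrand T]) simp
    finally show ?thesis .
  qed
  with bounded_linear.tendsto[OF T laplace_tendsto[OF z, of y]]
  show ?thesis using tendsto_unique[OF _ laplace_tendsto[OF z]] by simp
qed

lemma laplace_S: "Re z > \<omega>\<^sub>0 \<Longrightarrow> h \<ge> 0 \<Longrightarrow> laplace z (S h y) = S h (laplace z y)"
  by (rule laplace_intertwines) (auto simp: S_linear S_scaleC S_commute)

lemma laplace_scaleC: "Re z > \<omega>\<^sub>0 \<Longrightarrow> laplace z (c *\<^sub>C y) = c *\<^sub>C laplace z y"
  by (rule laplace_intertwines) (auto simp: bounded_linear_scaleC_right S_scaleC scaleC_scaleC mult.commute)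

text \<open>Applying \<open>S h\<close> shifts the orbit, hence the domain of integration from \<open>[0, N]\<close> to
  \<open>[h, N + h]\<close>; this is the identity from which the generator acts on the Laplace transform.\<close>
lemma S_laplace_shift:
  assumes z: "Re z > \<omega>\<^sub>0" and h: "h \<ge> 0"
  shows "S h (laplace z y) = exp (z * of_real h) *\<^sub>C
    (laplace z y - integral {0..h} (\<lambda>s. exp (- z * of_real s) *\<^sub>C S s y))"
proof -
  define f where "f = (\<lambda>s. exp (- z * of_real s) *\<^sub>C S s y)"
  have int: "f integrable_on {a..b}" if "a \<ge> 0" for a b
    unfolding f_def using that by (rule integrable_laplace_integrand)
  have lim: "((\<lambda>N. integral {0..N} f) \<longlongrightarrow> laplace z y) at_top"
    unfolding f_def by (rule laplace_tendsto[OF z])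
  have lim1: "((\<lambda>N. S h (integral {0..N} f)) \<longlongrightarrow> S h (laplace z y)) at_top"
    by (rule bounded_linear.tendsto[OF S_linear[OF h] lim])
  have shift: "S h (integral {0..N} f) = exp (z * of_real h) *\<^sub>C (integral {0..N + h} f - integral {0..h} f)"
    if N: "N \<ge> 0" for N
  proof -
    have "S h (integral {0..N} f) = integral {0..N} (S h \<circ> f)"
      using integral_linear[OF int S_linear[OF h]] by simp
    also have "\<dots> = integral {0..N} (\<lambda>s. exp (z * of_real h) *\<^sub>C (f \<circ> ((+) h)) s)"
    proof (rule Henstock_Kurzweil_Integration.integral_cong)
      fix s assume "s \<in> {0..N}"
      then have "S h (S s y) = S (h + s) y" using S_add[of h s y] h by simp
      moreover have "exp (- z * of_real s) = exp (z * of_real h) * exp (- z * of_real (h + s))"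
        by (simp add: exp_add[symmetric] algebra_simps)
      ultimately show "(S h \<circ> f) s = exp (z * of_real h) *\<^sub>C (f \<circ> ((+) h)) s"
        by (simp add: f_def S_scaleC[OF h] scaleC_scaleC)
    qed
    also have "\<dots> = exp (z * of_real h) *\<^sub>C integral {0..N} (f \<circ> ((+) h))"
    proof -
      have "(f \<circ> ((+) h)) integrable_on {0..N}"
        using int[of h "N + h"] h has_integral_shift_Icc_real[of f h _ 0 N]
        by (auto simp: integrable_on_def)
      from integral_linear[OF this bounded_linear_scaleC_right[of "exp (z * of_real h)"]]
      show ?thesis by (simp add: o_def)
    qed
    also have "integral {0..N} (f \<circ> ((+) h)) = integral {h..N + h} f"
      using integral_shift_Icc_real[of 0 N f h] by simp
    also have "\<dots> = integral {0..N + h} f - integral {0..h} f"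
      using Henstock_Kurzweil_Integration.integral_combine[of 0 h "N + h" f, symmetric] int h N by simp
    finally show ?thesis .
  qed
  have "((\<lambda>N. integral {0..N + h} f) \<longlongrightarrow> laplace z y) at_top"
    by (rule filterlim_compose[OF lim]) (rule filterlim_at_top_mono[OF filterlim_ident], simp add: h)
  then have "((\<lambda>N. exp (z * of_real h) *\<^sub>C (integral {0..N + h} f - integral {0..h} f))
      \<longlongrightarrow> exp (z * of_real h) *\<^sub>C (laplace z y - integral {0..h} f)) at_top"
    by (intro bounded_linear.tendsto[OF bounded_linear_scaleC_right] tendsto_intros)
  then have "((\<lambda>N. S h (integral {0..N} f)) \<longlongrightarrow> exp (z * of_real h) *\<^sub>C (laplace z y - integral {0..h} f)) at_top"
    by (rule Lim_transform_eventually)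
      (auto intro!: eventually_mono[OF eventually_ge_at_top[of 0]] simp: shift)
  from tendsto_unique[OF _ lim1 this] show ?thesis by (simp add: f_def)
qed

lemma laplace_difference_quotient:
  assumes z: "Re z > \<omega>\<^sub>0"
  shows "((\<lambda>h. (1 / h) *\<^sub>R (S h (laplace z y) - laplace z y)) \<longlongrightarrow> z *\<^sub>C laplace z y - y) (at_right 0)"
proof -
  define I where "I = (\<lambda>h. integral {0..h} (\<lambda>s. exp (- z * of_real s) *\<^sub>C S s y))"
  have "((\<lambda>w. exp (z * w)) has_field_derivative z) (at (of_real 0))"
    by (auto intro!: derivative_eq_intros)
  from has_vector_derivative_real_field[OF this]
  have "((\<lambda>h. exp (z * of_real h)) has_vector_derivative z) (at 0 within {0..1})" .
  from right_difference_quotient_tendsto[OF this]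
  have e1: "((\<lambda>h. (1 / h) *\<^sub>R (exp (z * of_real h) - 1)) \<longlongrightarrow> z) (at_right 0)" by simp
  have "(I has_vector_derivative y) (at 0 within {0..1})"
    using integral_has_vector_derivative[of 0 1 "\<lambda>s. exp (- z * of_real s) *\<^sub>C S s y" 0]
      continuous_on_subset[OF continuous_on_laplace_integrand, of "{0..1}" z y]
    by (simp add: I_def)
  from right_difference_quotient_tendsto[OF this]
  have e2: "((\<lambda>h. (1 / h) *\<^sub>R I h) \<longlongrightarrow> y) (at_right 0)" by (simp add: I_def)
  have e3: "((\<lambda>h. exp (z * of_real h)) \<longlongrightarrow> exp (z * of_real 0)) (at_right (0::real))"
    by (intro tendsto_intros)
  have "((\<lambda>h. ((1 / h) *\<^sub>R (exp (z * of_real h) - 1)) *\<^sub>C laplace z y - exp (z * of_real h) *\<^sub>C ((1 / h) *\<^sub>R I h))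
      \<longlongrightarrow> z *\<^sub>C laplace z y - exp (z * of_real 0) *\<^sub>C y) (at_right 0)"
    by (intro tendsto_diff bounded_bilinear.tendsto[OF bounded_bilinear_scaleC] e1 e2 e3 tendsto_const)
  then have "((\<lambda>h. ((1 / h) *\<^sub>R (exp (z * of_real h) - 1)) *\<^sub>C laplace z y - exp (z * of_real h) *\<^sub>C ((1 / h) *\<^sub>R I h))
      \<longlongrightarrow> z *\<^sub>C laplace z y - y) (at_right 0)" by simp
  then show ?thesis
  proof (rule Lim_transform_eventually)
    show "\<forall>\<^sub>F h in at_right 0. ((1 / h) *\<^sub>R (exp (z * of_real h) - 1)) *\<^sub>C laplace z y - exp (z * of_real h) *\<^sub>C ((1 / h) *\<^sub>R I h)
        = (1 / h) *\<^sub>R (S h (laplace z y) - laplace z y)"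
      using eventually_at_right_less[of 0]
    proof eventually_elim
      case (elim h)
      have "S h (laplace z y) = exp (z * of_real h) *\<^sub>C (laplace z y - I h)"
        unfolding I_def using elim by (intro S_laplace_shift[OF z]) simp
      then show ?case
        by (simp only: bounded_bilinear.scaleR_left[OF bounded_bilinear_scaleC]
            bounded_bilinear.scaleR_right[OF bounded_bilinear_scaleC]
            scaleC_diff_right scaleC_diff_left scaleR_diff_right scaleC_one) simp
    qed
  qed
qed

text \<open>The difference quotient of the Laplace transform shows that it maps into \<open>D\<close> and is a right
  inverse of \<open>z - A\<close>. It is also a left inverse, because it is bounded and commutes with \<open>S h\<close>, so that
  it may be exchanged with the limit defining \<open>A\<close>. The latter gives the injectivity on \<open>D\<close> that makes
  the inverse well defined.\<close>
theorem resolvent_eq_laplace: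
  assumes gen: "is_generator D A S" and z: "Re z > \<omega>\<^sub>0"
  shows "resolvent D A z y = laplace z y"
proof -
  have D: "D = {x. \<exists>y. ((\<lambda>h. (1 / h) *\<^sub>R (S h x - x)) \<longlongrightarrow> y) (at_right 0)}"
    and A: "\<And>x. x \<in> D \<Longrightarrow> ((\<lambda>h. (1 / h) *\<^sub>R (S h x - x)) \<longlongrightarrow> A x) (at_right 0)"
    using gen by (auto simp: is_generator_def)
  have inD: "laplace z y \<in> D"
    unfolding D using laplace_difference_quotient[OF z] by blast
  have "A (laplace z y) = z *\<^sub>C laplace z y - y"
    using tendsto_unique[OF _ A[OF inD] laplace_difference_quotient[OF z]] by simp
  then have right: "z *\<^sub>C laplace z y - A (laplace z y) = y" by simp
  have left: "laplace z (z *\<^sub>C x - A x) = x" if x: "x \<in> D" for x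
  proof -
    note lin = bounded_linear_laplace[OF z]
    have "((\<lambda>h. laplace z ((1 / h) *\<^sub>R (S h x - x))) \<longlongrightarrow> laplace z (A x)) (at_right 0)"
      by (rule bounded_linear.tendsto[OF lin A[OF x]])
    moreover have "\<forall>\<^sub>F h in at_right 0. laplace z ((1 / h) *\<^sub>R (S h x - x))
        = (1 / h) *\<^sub>R (S h (laplace z x) - laplace z x)"
      using eventually_at_right_less[of 0]
      by eventually_elim (simp add: linear_scale[OF bounded_linear.linear[OF lin]] linear_diff[OF bounded_linear.linear[OF lin]] laplace_S[OF z])
    ultimately have "((\<lambda>h. (1 / h) *\<^sub>R (S h (laplace z x) - laplace z x)) \<longlongrightarrow> laplace z (A x)) (at_right 0)"
      by (rule Lim_transform_eventually)
    from tendsto_unique[OF _ this laplace_difference_quotient[OF z]]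
    have "laplace z (A x) = z *\<^sub>C laplace z x - x" by simp
    then show ?thesis by (simp add: linear_diff[OF bounded_linear.linear[OF lin]] laplace_scaleC[OF z])
  qed
  have "inj_on (\<lambda>x. z *\<^sub>C x - A x) D"
    by (rule inj_on_inverseI[of _ "laplace z"]) (rule left)
  from inv_into_f_f[OF this inD] show ?thesis
    unfolding resolvent_def right .
qed

end

section \<open>Inversion of the Laplace transform of an orbit\<close>

lemma abs_exp_minus_one_le: "\<bar>exp x - 1\<bar> \<le> \<bar>x\<bar> * exp \<bar>x\<bar>" for x :: real
proof (cases "x \<ge> 0")
  case True
  have "(1 - x) * exp x \<le> exp (- x) * exp x"
    using exp_ge_add_one_self[of "- x"] by (intro mult_right_mono) auto
  then have "exp x - 1 \<le> x * exp x" by (simp add: exp_minus algebra_simps)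
  then show ?thesis using True by simp
next
  case False
  have "1 - exp x \<le> - x" using exp_ge_add_one_self[of x] by linarith
  also have "\<dots> \<le> - x * exp (- x)" using False by simp
  finally show ?thesis using False by simp
qed

lemma integral_exp_tendsto:
  fixes w :: complex
  assumes w: "Re w > 0"
  shows "((\<lambda>N. integral {0..N} (\<lambda>s. exp (- w * of_real s))) \<longlongrightarrow> 1 / w) at_top"
proof -
  have w0: "w \<noteq> 0" using w by auto
  have val: "integral {0..N} (\<lambda>s. exp (- w * of_real s)) = (1 - exp (- w * of_real N)) / w" if "N \<ge> 0" for N
  proof -
    have "((\<lambda>s. - exp (- w * of_real s) / w) has_vector_derivative exp (- w * of_real s)) (at s within {0..N})" for s
    proof -
      have 1: "((\<lambda>s. - exp (- w * s) / w) has_field_derivative exp (- w * of_real s)) (at (of_real s))"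
        using w0 by (auto intro!: derivative_eq_intros)
      show ?thesis using has_vector_derivative_real_field[OF 1, of "{0..N}"] by simp
    qed
    then have "((\<lambda>s. exp (- w * of_real s)) has_integral (- exp (- w * of_real N) / w - - exp (- w * of_real 0) / w)) {0..N}"
      by (intro fundamental_theorem_of_calculus that)
    then show ?thesis by (simp add: integral_unique diff_divide_distrib)
  qed
  have "((\<lambda>N. exp (- (Re w * N))) \<longlongrightarrow> 0) at_top"
    by (rule tendsto_exp_neg_mult_at_top[OF w])
  then have "((\<lambda>N. exp (- w * of_real N)) \<longlongrightarrow> 0) at_top"
    by (intro tendsto_norm_zero_cancel[of "\<lambda>N. exp (- w * of_real N)"]) simp
  then have "((\<lambda>N. (1 - exp (- w * of_real N)) / w) \<longlongrightarrow> (1 - 0) / w) at_top"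
    using w0 by (intro tendsto_intros)
  then have "((\<lambda>N. (1 - exp (- w * of_real N)) / w) \<longlongrightarrow> 1 / w) at_top" by simp
  then show ?thesis
    by (rule Lim_transform_eventually) (rule eventually_mono[OF eventually_ge_at_top[of 0]], rule val[symmetric])
qed

lemma vcontour_integral_vertical_linepath:
  fixes G :: "complex \<Rightarrow> 'a::cbanach"
  assumes R: "R > 0" and int: "(\<lambda>\<eta>. G (Complex \<omega> \<eta>)) integrable_on {- R..R}"
  shows "(1 / (2 * of_real pi * \<i>)) *\<^sub>C vcontour_integral G (linepath (Complex \<omega> (- R)) (Complex \<omega> R))
    = (1 / (2 * pi)) *\<^sub>R integral {- R..R} (\<lambda>\<eta>. G (Complex \<omega> \<eta>))"
proof -
  define J where "J = integral {- R..R} (\<lambda>\<eta>. G (Complex \<omega> \<eta>))"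
  have path: "linepath (Complex \<omega> (- R)) (Complex \<omega> R) s = Complex \<omega> (2 * R * s + - R)" for s
    by (simp add: linepath_def complex_eq_iff algebra_simps)
  have "((\<lambda>\<eta>. G (Complex \<omega> \<eta>)) has_integral J) (cbox (- R) R)"
    using int unfolding J_def by (simp add: integrable_integral)
  from has_integral_affinity'[OF this, of "2 * R" "- R"]
  have "((\<lambda>s. G (Complex \<omega> (2 * R * s + - R))) has_integral (J /\<^sub>R (2 * R))) {0..1}"
    using R by (simp add: field_simps)
  note has_integral_linear[OF this bounded_linear_scaleC_right[of "2 * of_real R * \<i>"]]
  moreover have "(2 * of_real R * \<i>) *\<^sub>C (J /\<^sub>R (2 * R)) = \<i> *\<^sub>C J"
    using R by (simp add: scaleC_scaleR field_simps)
  ultimately have "((\<lambda>s. (2 * of_real R * \<i>) *\<^sub>C G (Complex \<omega> (2 * R * s + - R))) has_integral \<i> *\<^sub>C J) {0..1}"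
    by (simp only: o_def)
  moreover have "Complex \<omega> R - Complex \<omega> (- R) = 2 * of_real R * \<i>"
    by (simp add: complex_eq_iff)
  ultimately have "vcontour_integral G (linepath (Complex \<omega> (- R)) (Complex \<omega> R)) = \<i> *\<^sub>C J"
    unfolding vcontour_integral_def
    by (intro integral_unique) (auto intro: has_integral_eq[rotated] simp: vector_derivative_linepath_within path)
  then show ?thesis
    using scaleC_of_real[of "1 / (2 * pi)" J] by (simp add: scaleC_scaleC J_def)
qed

context decaying_semigroup
begin

text \<open>The parameter \<open>\<kappa>\<close> treats both inversion formulas at once: \<open>\<kappa> = 1\<close> subtracts
  \<open>e\<^bsup>\<omega>\<^sub>0s\<^esup>y\<close>, so that the function vanishes at \<open>0\<close>, and \<open>\<kappa> = 0\<close> is the plain orbit.\<close>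
definition damped_orbit :: "real \<Rightarrow> real \<Rightarrow> 'a \<Rightarrow> real \<Rightarrow> 'a" where
  "damped_orbit \<kappa> \<omega> y s = exp (- \<omega> * s) *\<^sub>R (S s y - (\<kappa> * exp (\<omega>\<^sub>0 * s)) *\<^sub>R y)"

text \<open>The Fourier transform of the damped orbit, extended by \<open>0\<close> to the negative half line
  (\<open>damped_transform_tail\<close>).\<close>
definition damped_transform :: "real \<Rightarrow> real \<Rightarrow> 'a \<Rightarrow> real \<Rightarrow> 'a" where
  "damped_transform \<kappa> \<omega> y \<eta> = laplace (Complex \<omega> \<eta>) y - (of_real \<kappa> / (Complex \<omega> \<eta> - of_real \<omega>\<^sub>0)) *\<^sub>C y"

definition truncated_inversion :: "real \<Rightarrow> real \<Rightarrow> real \<Rightarrow> real \<Rightarrow> 'a \<Rightarrow> 'a" where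
  "truncated_inversion \<kappa> \<omega> R t y =
     (exp (\<omega> * t) / (2 * pi)) *\<^sub>R integral {- R..R} (\<lambda>\<eta>. cis (\<eta> * t) *\<^sub>C damped_transform \<kappa> \<omega> y \<eta>)"

lemma norm_damped_orbit_le:
  assumes k: "0 \<le> \<kappa>" "\<kappa> \<le> 1" and s: "s \<ge> 0"
  shows "norm (damped_orbit \<kappa> \<omega> y s) \<le> (C + 1) * norm y * exp (- (\<omega> - \<omega>\<^sub>0) * s)"
proof -
  have "norm (S s y - (\<kappa> * exp (\<omega>\<^sub>0 * s)) *\<^sub>R y) \<le> norm (S s y) + norm ((\<kappa> * exp (\<omega>\<^sub>0 * s)) *\<^sub>R y)"
    by (rule norm_triangle_ineq4)
  also have "\<dots> \<le> C * exp (\<omega>\<^sub>0 * s) * norm y + 1 * exp (\<omega>\<^sub>0 * s) * norm y"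
    unfolding norm_scaleR abs_mult using k
    by (intro add_mono bound[OF s] mult_right_mono) auto
  finally have "norm (S s y - (\<kappa> * exp (\<omega>\<^sub>0 * s)) *\<^sub>R y) \<le> (C + 1) * norm y * exp (\<omega>\<^sub>0 * s)"
    by (simp add: algebra_simps)
  then have "norm (damped_orbit \<kappa> \<omega> y s) \<le> exp (- \<omega> * s) * ((C + 1) * norm y * exp (\<omega>\<^sub>0 * s))"
    unfolding damped_orbit_def norm_scaleR by (intro mult_mono) auto
  moreover have "exp (- (\<omega> - \<omega>\<^sub>0) * s) = exp (- \<omega> * s) * exp (\<omega>\<^sub>0 * s)"
    by (simp add: exp_add[symmetric] algebra_simps)
  ultimately show ?thesis by (simp add: mult_ac)
qed

text \<open>The first summand comes from the increments of the orbit and of \<open>e\<^bsup>\<omega>\<^sub>0s\<^esup>\<close>, the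
  second from the increments of the weight \<open>e\<^bsup>-\<omega>s\<^esup>\<close> and from the size of the damped orbit.\<close>
definition hoelder_constant :: "real \<Rightarrow> real" where
  "hoelder_constant \<omega> = exp \<bar>\<omega>\<bar> * (C + \<bar>\<omega>\<^sub>0\<bar>) + (\<bar>\<omega>\<bar> * exp \<bar>\<omega>\<bar> + 1) * (C + 1)"

lemma hoelder_constant_ge: "C + 1 \<le> hoelder_constant \<omega>"
  using C_pos by (simp add: hoelder_constant_def algebra_simps)

text \<open>By the semigroup law the increment of the orbit over \<open>[s, s + h]\<close> is \<open>S s\<close> applied to the increment
  over \<open>[0, h]\<close>, so a Hoelder bound at \<open>0\<close> propagates with the decay of the semigroup. The two
  exponential factors are Lipschitz, and \<open>h \<le> h\<^sup>\<beta>\<close> for \<open>h \<le> 1\<close>.\<close>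
lemma decaying_hoelder_damped_orbit:
  assumes k: "0 \<le> \<kappa>" "\<kappa> \<le> 1" and b: "0 < \<beta>" "\<beta> \<le> 1"
    and y: "norm y \<le> m" and hoelder: "\<And>s. 0 \<le> s \<Longrightarrow> s \<le> 1 \<Longrightarrow> norm (S s y - y) \<le> m * s powr \<beta>"
  shows "decaying_hoelder \<beta> (\<omega> - \<omega>\<^sub>0) (hoelder_constant \<omega> * m) (damped_orbit \<kappa> \<omega> y)"
proof -
  define f where "f = damped_orbit \<kappa> \<omega> y"
  have m: "m \<ge> 0" using y norm_ge_zero order_trans by blast
  have f_le: "norm (f s) \<le> (C + 1) * m * exp (- (\<omega> - \<omega>\<^sub>0) * s)" if "s \<ge> 0" for s
  proof -
    have "(C + 1) * norm y * exp (- (\<omega> - \<omega>\<^sub>0) * s) \<le> (C + 1) * m * exp (- (\<omega> - \<omega>\<^sub>0) * s)"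
      using y C_pos by (intro mult_right_mono mult_left_mono) auto
    then show ?thesis using norm_damped_orbit_le[OF k that, of \<omega> y] by (simp add: f_def)
  qed
  have "norm (f s) \<le> hoelder_constant \<omega> * m * exp (- (\<omega> - \<omega>\<^sub>0) * s)" if "s \<ge> 0" for s
    by (rule order_trans[OF f_le[OF that]])
      (intro mult_right_mono hoelder_constant_ge m, simp)
  moreover have "norm (f (s + h) - f s) \<le> hoelder_constant \<omega> * m * h powr \<beta> * exp (- (\<omega> - \<omega>\<^sub>0) * s)"
    if s: "s \<ge> 0" and h: "0 \<le> h" "h \<le> 1" for s h
  proof -
    have hb: "h \<le> h powr \<beta>"
      using powr_mono'[of \<beta> 1 h] b h by (cases "h = 0") simp_all
    define E where "E = exp (- (\<omega> - \<omega>\<^sub>0) * s)"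
    define u where "u = S s (S h y - y)"
    define v where "v = (\<kappa> * exp (\<omega>\<^sub>0 * s) * (exp (\<omega>\<^sub>0 * h) - 1)) *\<^sub>R y"
    have exp_split: "exp (- \<omega> * (s + h)) = exp (- \<omega> * h) * exp (- \<omega> * s)"
      by (simp add: exp_add[symmetric] algebra_simps)
    have E: "E = exp (- \<omega> * s) * exp (\<omega>\<^sub>0 * s)"
      by (simp add: E_def exp_add[symmetric] algebra_simps)
    have "S (s + h) y - (\<kappa> * exp (\<omega>\<^sub>0 * (s + h))) *\<^sub>R y = (u - v) + (S s y - (\<kappa> * exp (\<omega>\<^sub>0 * s)) *\<^sub>R y)"
      unfolding u_def v_def S_add[OF s h(1)] S_diff[OF s] distrib_left exp_add
      by (simp add: algebra_simps)
    then have "f (s + h) - f s = exp (- \<omega> * (s + h)) *\<^sub>R (u - v) + (exp (- \<omega> * h) - 1) *\<^sub>R f s"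
      unfolding f_def damped_orbit_def by (simp only: exp_split) (simp add: algebra_simps)
    then have "norm (f (s + h) - f s) \<le> exp (- \<omega> * (s + h)) * norm (u - v) + \<bar>exp (- \<omega> * h) - 1\<bar> * norm (f s)"
      using norm_triangle_ineq[of "exp (- \<omega> * (s + h)) *\<^sub>R (u - v)" "(exp (- \<omega> * h) - 1) *\<^sub>R f s"] by simp
    also have "\<dots> \<le> (exp \<bar>\<omega>\<bar> * exp (- \<omega> * s)) * ((C + \<bar>\<omega>\<^sub>0\<bar>) * m * h powr \<beta> * exp (\<omega>\<^sub>0 * s))
        + (\<bar>\<omega>\<bar> * exp \<bar>\<omega>\<bar> * h powr \<beta>) * ((C + 1) * m * E)"
    proof (intro add_mono mult_mono)
      have wh: "\<bar>\<omega> * h\<bar> \<le> \<bar>\<omega>\<bar>" using h by (simp add: abs_mult mult_left_le)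
      then have "exp (- \<omega> * h) \<le> exp \<bar>\<omega>\<bar>" by simp
      then show "exp (- \<omega> * (s + h)) \<le> exp \<bar>\<omega>\<bar> * exp (- \<omega> * s)"
        unfolding exp_split by (intro mult_right_mono) auto
      have "\<bar>exp (- \<omega> * h) - 1\<bar> \<le> \<bar>- \<omega> * h\<bar> * exp \<bar>- \<omega> * h\<bar>" by (rule abs_exp_minus_one_le)
      also have "\<dots> \<le> (\<bar>\<omega>\<bar> * h powr \<beta>) * exp \<bar>\<omega>\<bar>"
        using wh hb h by (intro mult_mono) (auto simp: abs_mult mult_left_mono)
      finally show "\<bar>exp (- \<omega> * h) - 1\<bar> \<le> \<bar>\<omega>\<bar> * exp \<bar>\<omega>\<bar> * h powr \<beta>" by (simp add: mult_ac)
      show "norm (f s) \<le> (C + 1) * m * E" using f_le[OF s] by (simp add: E_def)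
      have u: "norm u \<le> C * exp (\<omega>\<^sub>0 * s) * (m * h powr \<beta>)"
        unfolding u_def using bound[OF s, of "S h y - y"] hoelder[OF h] C_pos
        by (meson mult_left_mono mult_nonneg_nonneg exp_ge_zero less_imp_le order_trans)
      have "1 - exp (\<omega>\<^sub>0 * h) \<le> \<bar>\<omega>\<^sub>0\<bar> * h"
        using exp_ge_add_one_self[of "\<omega>\<^sub>0 * h"] neg by (simp only: abs_of_neg)
      moreover have "exp (\<omega>\<^sub>0 * h) \<le> 1" using neg h by (simp add: mult_nonpos_nonneg)
      ultimately have "\<bar>exp (\<omega>\<^sub>0 * h) - 1\<bar> \<le> \<bar>\<omega>\<^sub>0\<bar> * h powr \<beta>"
        using mult_left_mono[OF hb, of "\<bar>\<omega>\<^sub>0\<bar>"] by linarith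
      then have "norm v \<le> (1 * exp (\<omega>\<^sub>0 * s) * (\<bar>\<omega>\<^sub>0\<bar> * h powr \<beta>)) * m"
        unfolding v_def norm_scaleR abs_mult using k y m by (intro mult_mono) auto
      then have "norm u + norm v \<le> (C + \<bar>\<omega>\<^sub>0\<bar>) * m * h powr \<beta> * exp (\<omega>\<^sub>0 * s)"
        using u by (simp add: algebra_simps)
      then show "norm (u - v) \<le> (C + \<bar>\<omega>\<^sub>0\<bar>) * m * h powr \<beta> * exp (\<omega>\<^sub>0 * s)"
        using norm_triangle_ineq4[of u v] by linarith
    qed auto
    also have "\<dots> = (exp \<bar>\<omega>\<bar> * (C + \<bar>\<omega>\<^sub>0\<bar>) + \<bar>\<omega>\<bar> * exp \<bar>\<omega>\<bar> * (C + 1)) * (m * h powr \<beta> * E)"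
      unfolding E by (simp add: algebra_simps)
    also have "\<dots> \<le> hoelder_constant \<omega> * (m * h powr \<beta> * E)"
      using m C_pos by (intro mult_right_mono) (auto simp: hoelder_constant_def E_def algebra_simps)
    finally show ?thesis by (simp add: E_def mult_ac)
  qed
  ultimately show ?thesis unfolding decaying_hoelder_def f_def by auto
qed

lemma continuous_on_damped_orbit: "continuous_on {0..} (damped_orbit \<kappa> \<omega> y)"
  unfolding damped_orbit_def by (intro continuous_intros orbit_continuous)

lemma damped_transform_tail:
  assumes k: "0 \<le> \<kappa>" "\<kappa> \<le> 1" and w: "\<omega> > \<omega>\<^sub>0" and M: "(C + 1) * norm y \<le> M" and N: "N \<ge> 0"
  shows "norm (damped_transform \<kappa> \<omega> y \<eta> - integral {0..N} (\<lambda>s. cis (- \<eta> * s) *\<^sub>C damped_orbit \<kappa> \<omega> y s))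
    \<le> M * exp (- (\<omega> - \<omega>\<^sub>0) * N) / (\<omega> - \<omega>\<^sub>0)"
proof -
  define z where "z = Complex \<omega> \<eta>"
  define f where "f = (\<lambda>s. cis (- \<eta> * s) *\<^sub>C damped_orbit \<kappa> \<omega> y s)"
  have cont: "continuous_on {0..} f"
    unfolding f_def by (intro continuous_intros continuous_on_cis continuous_on_damped_orbit)
  have M0: "0 \<le> M" using M C_pos by (meson add_nonneg_nonneg less_imp_le mult_nonneg_nonneg norm_ge_zero order_trans zero_le_one)
  have le: "norm (f s) \<le> M * exp (- (\<omega> - \<omega>\<^sub>0) * s)" if "s \<ge> 0" for s
  proof -
    have "norm (f s) = norm (damped_orbit \<kappa> \<omega> y s)" by (simp add: f_def norm_scaleC)
    also have "\<dots> \<le> (C + 1) * norm y * exp (- (\<omega> - \<omega>\<^sub>0) * s)"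
      by (rule norm_damped_orbit_le[OF k that])
    also have "\<dots> \<le> M * exp (- (\<omega> - \<omega>\<^sub>0) * s)"
      by (intro mult_right_mono M) auto
    finally show ?thesis .
  qed
  obtain F where F: "((\<lambda>N. integral {0..N} f) \<longlongrightarrow> F) at_top"
    and tail: "\<And>N. N \<ge> 0 \<Longrightarrow> norm (F - integral {0..N} f) \<le> M * exp (- (\<omega> - \<omega>\<^sub>0) * N) / (\<omega> - \<omega>\<^sub>0)"
    using improper_integral_exp_tail[OF cont _ M0 le] w by auto
  have split: "f s = exp (- z * of_real s) *\<^sub>C S s y - (of_real \<kappa> * exp (- (z - of_real \<omega>\<^sub>0) * of_real s)) *\<^sub>C y" for s
  proof -
    have "exp (- z * of_real s) = cis (- \<eta> * s) * of_real (exp (- \<omega> * s))"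
      unfolding cis_conv_exp exp_of_real[symmetric] exp_add[symmetric]
      by (rule arg_cong[where f = exp]) (simp add: z_def complex_eq_iff)
    moreover have "exp (- (z - of_real \<omega>\<^sub>0) * of_real s) = exp (- z * of_real s) * of_real (exp (\<omega>\<^sub>0 * s))"
      unfolding exp_of_real[symmetric] exp_add[symmetric] by (simp add: algebra_simps)
    ultimately show ?thesis
      by (simp add: f_def damped_orbit_def scaleR_diff_right scaleC_diff_right scaleC_scaleR mult_ac)
  qed
  have ints: "integral {0..N} f = integral {0..N} (\<lambda>s. exp (- z * of_real s) *\<^sub>C S s y)
      - (of_real \<kappa> * integral {0..N} (\<lambda>s. exp (- (z - of_real \<omega>\<^sub>0) * of_real s))) *\<^sub>C y" for N
  proof -
    have i: "(\<lambda>s. of_real \<kappa> * exp (- (z - of_real \<omega>\<^sub>0) * of_real s)) integrable_on {0..N}"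
      by (intro integrable_continuous_real continuous_intros)
    note j = integrable_linear[OF i bounded_linear_scaleC_left[of y], unfolded o_def]
    have "integral {0..N} f = integral {0..N} (\<lambda>s. exp (- z * of_real s) *\<^sub>C S s y)
        - integral {0..N} (\<lambda>s. (of_real \<kappa> * exp (- (z - of_real \<omega>\<^sub>0) * of_real s)) *\<^sub>C y)"
      unfolding split
      by (rule Henstock_Kurzweil_Integration.integral_diff[OF integrable_laplace_integrand[OF order_refl] j])
    moreover have "integral {0..N} (\<lambda>s. (of_real \<kappa> * exp (- (z - of_real \<omega>\<^sub>0) * of_real s)) *\<^sub>C y)
        = (of_real \<kappa> * integral {0..N} (\<lambda>s. exp (- (z - of_real \<omega>\<^sub>0) * of_real s))) *\<^sub>C y"
      using integral_linear[OF i bounded_linear_scaleC_left[of y]] by (simp only: o_def integral_mult_right)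
    ultimately show ?thesis by simp
  qed
  have "((\<lambda>N. integral {0..N} f) \<longlongrightarrow> laplace z y - (of_real \<kappa> * (1 / (z - of_real \<omega>\<^sub>0))) *\<^sub>C y) at_top"
    unfolding ints
    by (intro tendsto_diff laplace_tendsto bounded_linear.tendsto[OF bounded_linear_scaleC_left]
        tendsto_mult tendsto_const integral_exp_tendsto) (use w in \<open>simp_all add: z_def\<close>)
  from tendsto_unique[OF _ F this] have "F = damped_transform \<kappa> \<omega> y \<eta>"
    by (simp add: damped_transform_def z_def)
  with tail[OF N] show ?thesis by (simp add: f_def)
qed

lemma integrable_damped_transform:
  assumes k: "0 \<le> \<kappa>" "\<kappa> \<le> 1" and w: "\<omega> > \<omega>\<^sub>0" and R: "R > 0"
  shows "(\<lambda>\<eta>. cis (\<eta> * t) *\<^sub>C damped_transform \<kappa> \<omega> y \<eta>) integrable_on {- R..R}"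
proof (rule fourier_inversion_as_limit(1)[OF continuous_on_damped_orbit R])
  show "0 < \<omega> - \<omega>\<^sub>0" "0 \<le> (C + 1) * norm y" using w C_pos by simp_all
qed (rule damped_transform_tail[OF k w order_refl])

text \<open>The operator \<open>S h - 1\<close> commutes with the Laplace transform and, being bounded, with the
  integral. Hence the increment of the error at \<open>y\<close> is the error at the increment of \<open>y\<close>.\<close>
lemma truncated_inversion_S_diff:
  assumes k: "0 \<le> \<kappa>" "\<kappa> \<le> 1" and w: "\<omega> > \<omega>\<^sub>0" and R: "R > 0" and h: "h \<ge> 0"
  shows "truncated_inversion \<kappa> \<omega> R t (S h y - y)
    = S h (truncated_inversion \<kappa> \<omega> R t y) - truncated_inversion \<kappa> \<omega> R t y"
proof -
  note int = integrable_damped_transform[OF k w R, of t y]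
  define T where "T = (\<lambda>x. S h x - x)"
  have T: "bounded_linear T"
    unfolding T_def by (intro bounded_linear_sub S_linear[OF h] bounded_linear_ident)
  have TC: "T (c *\<^sub>C x) = c *\<^sub>C T x" for c x
    by (simp add: T_def S_scaleC[OF h] scaleC_diff_right)
  have trans: "damped_transform \<kappa> \<omega> (T y) \<eta> = T (damped_transform \<kappa> \<omega> y \<eta>)" for \<eta>
  proof -
    have z: "Re (Complex \<omega> \<eta>) > \<omega>\<^sub>0" using w by simp
    have "laplace (Complex \<omega> \<eta>) (T y) = T (laplace (Complex \<omega> \<eta>) y)"
      by (rule laplace_intertwines[OF z T])
        (use h in \<open>simp_all add: TC, simp add: T_def S_diff S_commute\<close>)
    then show ?thesis
      by (simp add: damped_transform_def TC linear_diff[OF bounded_linear.linear[OF T]])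
  qed
  have "integral {- R..R} (\<lambda>\<eta>. cis (\<eta> * t) *\<^sub>C damped_transform \<kappa> \<omega> (T y) \<eta>)
      = T (integral {- R..R} (\<lambda>\<eta>. cis (\<eta> * t) *\<^sub>C damped_transform \<kappa> \<omega> y \<eta>))"
    using integral_linear[OF int T] by (simp add: o_def trans TC)
  then have "truncated_inversion \<kappa> \<omega> R t (T y) = T (truncated_inversion \<kappa> \<omega> R t y)"
    by (simp add: truncated_inversion_def linear_scale[OF bounded_linear.linear[OF T]])
  then show ?thesis by (simp add: T_def)
qed

lemma truncated_inversion_eq_contour_integral:
  assumes gen: "is_generator D A S"
    and k: "0 \<le> \<kappa>" "\<kappa> \<le> 1" and w: "\<omega> > \<omega>\<^sub>0" and R: "R > 0"
  shows "(1 / (2 * of_real pi * \<i>)) *\<^sub>C vcontour_integral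
      (\<lambda>z. exp (z * of_real t) *\<^sub>C (resolvent D A z y - (of_real \<kappa> / (z - of_real \<omega>\<^sub>0)) *\<^sub>C y))
      (linepath (Complex \<omega> (- R)) (Complex \<omega> R)) = truncated_inversion \<kappa> \<omega> R t y"
proof -
  have eq: "exp (Complex \<omega> \<eta> * of_real t) *\<^sub>C (resolvent D A (Complex \<omega> \<eta>) y - (of_real \<kappa> / (Complex \<omega> \<eta> - of_real \<omega>\<^sub>0)) *\<^sub>C y)
      = exp (\<omega> * t) *\<^sub>R (cis (\<eta> * t) *\<^sub>C damped_transform \<kappa> \<omega> y \<eta>)" for \<eta>
  proof -
    have "exp (Complex \<omega> \<eta> * of_real t) = of_real (exp (\<omega> * t)) * cis (\<eta> * t)"
      unfolding cis_conv_exp exp_of_real[symmetric] exp_add[symmetric]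
      by (rule arg_cong[where f = exp]) (simp add: complex_eq_iff)
    then show ?thesis
      using resolvent_eq_laplace[OF gen, of "Complex \<omega> \<eta>"] w
      by (simp add: damped_transform_def scaleR_scaleC)
  qed
  note int = integrable_cmul[OF integrable_damped_transform[OF k w R, of t y], of "exp (\<omega> * t)"]
  show ?thesis
    by (subst vcontour_integral_vertical_linepath[OF R])
      (simp_all only: eq int, simp add: truncated_inversion_def)
qed

text \<open>The uniformity over all \<open>y\<close> with the same bound \<open>m\<close> is what makes this applicable to the whole
  family of increments \<open>S h x - x\<close> at once.\<close>
theorem uniform_truncated_inversion:
  assumes k: "0 \<le> \<kappa>" "\<kappa> \<le> 1" and w: "\<omega> > \<omega>\<^sub>0" and b: "0 < \<beta>" "\<beta> \<le> 1"
    and tau: "0 < \<tau>" and e: "0 < e"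
  shows "\<forall>\<^sub>F R in at_top. \<forall>y m t. norm y \<le> m \<longrightarrow> (\<forall>s\<in>{0..1}. norm (S s y - y) \<le> m * s powr \<beta>) \<longrightarrow>
    0 \<le> t \<longrightarrow> t \<le> T \<longrightarrow> \<tau> \<le> t \<or> \<kappa> = 1 \<longrightarrow>
    norm (truncated_inversion \<kappa> \<omega> R t y - (S t y - (\<kappa> * exp (\<omega>\<^sub>0 * t)) *\<^sub>R y)) \<le> e * m"
proof -
  define K where "K = hoelder_constant \<omega>"
  have K: "K > 0" using hoelder_constant_ge[of \<omega>] C_pos by (simp add: K_def)
  define r where "r = e / (K * exp (\<bar>\<omega>\<bar> * T))"
  have r: "r > 0" using e K by (simp add: r_def)
  have "\<omega> - \<omega>\<^sub>0 > 0" using w by simp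
  from uniform_fourier_inversion[OF b this tau r, where 'a = 'a] show ?thesis
  proof eventually_elim
    case (elim R)
    show ?case
    proof (intro allI impI)
      fix y m t
      assume y: "norm y \<le> m" "\<forall>s\<in>{0..1}. norm (S s y - y) \<le> m * s powr \<beta>"
        and t: "0 \<le> t" "t \<le> T" "\<tau> \<le> t \<or> \<kappa> = 1"
      define J where "J = (1 / (2 * pi)) *\<^sub>R integral {- R..R} (\<lambda>\<eta>. cis (\<eta> * t) *\<^sub>C damped_transform \<kappa> \<omega> y \<eta>)"
      have m: "m \<ge> 0" using y(1) norm_ge_zero order_trans by blast
      have M: "(C + 1) * norm y \<le> K * m"
        unfolding K_def using y(1) C_pos hoelder_constant_ge[of \<omega>] by (intro mult_mono) auto
      have dh: "decaying_hoelder \<beta> (\<omega> - \<omega>\<^sub>0) (K * m) (damped_orbit \<kappa> \<omega> y)"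
        unfolding K_def by (rule decaying_hoelder_damped_orbit[OF k b y(1)]) (use y(2) in auto)
      have "norm (J - damped_orbit \<kappa> \<omega> y t) \<le> r * (K * m)"
        unfolding J_def
        using elim[rule_format, OF dh damped_transform_tail[OF k w M] t(1)] t(3)
        by (auto simp: damped_orbit_def)
      moreover have "truncated_inversion \<kappa> \<omega> R t y - (S t y - (\<kappa> * exp (\<omega>\<^sub>0 * t)) *\<^sub>R y)
          = exp (\<omega> * t) *\<^sub>R (J - damped_orbit \<kappa> \<omega> y t)"
        by (simp add: J_def truncated_inversion_def damped_orbit_def scaleR_diff_right[of "exp (\<omega> * t)"]
            exp_add[symmetric])
      moreover have "exp (\<omega> * t) \<le> exp (\<bar>\<omega>\<bar> * T)"
        using t by (intro exp_le_cancel_iff[THEN iffD2] mult_mono) auto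
      ultimately have "norm (truncated_inversion \<kappa> \<omega> R t y - (S t y - (\<kappa> * exp (\<omega>\<^sub>0 * t)) *\<^sub>R y))
          \<le> exp (\<bar>\<omega>\<bar> * T) * (r * (K * m))"
        by (simp add: mult_mono)
      also have "\<dots> = e * m" using K by (simp add: r_def)
      finally show "norm (truncated_inversion \<kappa> \<omega> R t y - (S t y - (\<kappa> * exp (\<omega>\<^sub>0 * t)) *\<^sub>R y)) \<le> e * m" .
    qed
  qed
qed

end

section \<open>Favard spaces\<close>

lemma favard_space_boundE:
  assumes "x \<in> favard_space S \<alpha>"
  obtains m where "0 \<le> m" "\<And>h. h > 0 \<Longrightarrow> norm (S h x - x) \<le> m * h powr \<alpha>"
proof
  have fin: "favard_norm S \<alpha> x < \<infinity>" using assms by (simp add: favard_space_def)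
  show "0 \<le> enn2real (favard_norm S \<alpha> x)" by simp
  fix h :: real assume h: "h > 0"
  have "ennreal (1 / h powr \<alpha> * norm (S h x - x)) \<le> favard_norm S \<alpha> x"
    unfolding favard_norm_def by (rule SUP_upper) (use h in simp)
  also have "\<dots> = ennreal (enn2real (favard_norm S \<alpha> x))"
    using fin by simp
  finally have "1 / h powr \<alpha> * norm (S h x - x) \<le> enn2real (favard_norm S \<alpha> x)"
    by (simp add: ennreal_le_iff)
  then show "norm (S h x - x) \<le> enn2real (favard_norm S \<alpha> x) * h powr \<alpha>"
    using h by (simp add: field_simps)
qed

lemma favard_norm_le:
  assumes "\<And>h. h > 0 \<Longrightarrow> norm (S h x - x) \<le> c * h powr \<alpha>"
  shows "favard_norm S \<alpha> x \<le> ennreal c"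
  unfolding favard_norm_def
proof (rule SUP_least)
  fix h :: real assume "h \<in> {0<..}"
  then have "1 / h powr \<alpha> * norm (S h x - x) \<le> c"
    using assms[of h] by (simp add: field_simps)
  then show "ennreal (1 / h powr \<alpha> * norm (S h x - x)) \<le> ennreal c" by (rule ennreal_leI)
qed

context decaying_semigroup
begin

text \<open>Interpolation: the second difference \<open>(S s - 1)(S h - 1)x\<close> is symmetric in \<open>s\<close> and \<open>h\<close>, hence, up to a constant,
  bounded by the smaller of \<open>s\<^sup>\<alpha>\<close> and \<open>h\<^sup>\<alpha>\<close>, and \<open>(min s h)\<^sup>\<alpha> \<le> h\<^sup>\<beta> s\<^bsup>\<alpha> - \<beta>\<^esup>\<close>.\<close>
lemma
  assumes x: "norm x \<le> m" "\<And>h. h > 0 \<Longrightarrow> norm (S h x - x) \<le> m * h powr \<alpha>"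
    and b: "0 < \<beta>" "\<beta> < \<alpha>" and h: "h > 0"
  shows norm_increment_le: "norm (S h x - x) \<le> (C + 1) * m * h powr \<beta>"
    and increment_hoelder:
      "s \<ge> 0 \<Longrightarrow> norm (S s (S h x - x) - (S h x - x)) \<le> (C + 1) * m * h powr \<beta> * s powr (\<alpha> - \<beta>)"
proof -
  have m: "m \<ge> 0" using x(1) norm_ge_zero order_trans by blast
  have T: "norm (S t y - y) \<le> (C + 1) * norm y" if "t \<ge> 0" for t y
    using norm_triangle_ineq4[of "S t y" y] norm_S_le[OF that, of y] by (simp add: algebra_simps)
  show "norm (S h x - x) \<le> (C + 1) * m * h powr \<beta>"
  proof (cases "h \<le> 1")
    case True
    have "norm (S h x - x) \<le> 1 * m * h powr \<alpha>" using x(2)[OF h] by simp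
    also have "\<dots> \<le> (C + 1) * m * h powr \<beta>"
      using m C_pos b h True by (intro mult_mono powr_mono') auto
    finally show ?thesis .
  next
    case False
    have "norm (S h x - x) \<le> (C + 1) * norm x" using T h by simp
    also have "\<dots> \<le> (C + 1) * m" using x(1) C_pos by simp
    also have "\<dots> \<le> (C + 1) * m * h powr \<beta>"
      using False b m C_pos ge_one_powr_ge_zero[of h \<beta>]
        mult_left_mono[of 1 "h powr \<beta>" "(C + 1) * m"] by simp
    finally show ?thesis .
  qed
  assume s: "s \<ge> 0"
  show "norm (S s (S h x - x) - (S h x - x)) \<le> (C + 1) * m * h powr \<beta> * s powr (\<alpha> - \<beta>)"
  proof (cases "s = 0")
    case False
    then have s0: "s > 0" using s by simp
    have swap: "S s (S h x - x) - (S h x - x) = S h (S s x - x) - (S s x - x)"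
      using s h by (simp add: S_diff S_commute[of s h])
    have "norm (S s (S h x - x) - (S h x - x)) \<le> (C + 1) * (m * (h powr \<beta> * s powr (\<alpha> - \<beta>)))"
    proof (cases "h \<le> s")
      case True
      have "norm (S s (S h x - x) - (S h x - x)) \<le> (C + 1) * norm (S h x - x)" using T[OF s] .
      also have "\<dots> \<le> (C + 1) * (m * h powr \<alpha>)" using x(2)[OF h] C_pos by simp
      also have "h powr \<alpha> = h powr \<beta> * h powr (\<alpha> - \<beta>)" by (simp flip: powr_add)
      also have "(C + 1) * (m * (h powr \<beta> * h powr (\<alpha> - \<beta>))) \<le> (C + 1) * (m * (h powr \<beta> * s powr (\<alpha> - \<beta>)))"
        using m C_pos True h b by (intro mult_left_mono powr_mono2) auto
      finally show ?thesis .
    next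
      case False
      have "norm (S s (S h x - x) - (S h x - x)) \<le> (C + 1) * norm (S s x - x)"
        unfolding swap using T[of h "S s x - x"] h by simp
      also have "\<dots> \<le> (C + 1) * (m * s powr \<alpha>)" using x(2)[OF s0] C_pos by simp
      also have "s powr \<alpha> = s powr \<beta> * s powr (\<alpha> - \<beta>)" by (simp flip: powr_add)
      also have "(C + 1) * (m * (s powr \<beta> * s powr (\<alpha> - \<beta>))) \<le> (C + 1) * (m * (h powr \<beta> * s powr (\<alpha> - \<beta>)))"
        using m C_pos False s b by (intro mult_left_mono mult_right_mono powr_mono2) auto
      finally show ?thesis .
    qed
    then show ?thesis by (simp add: mult_ac)
  qed (use m C_pos in simp)
qed

text \<open>The error commutes with \<open>S h - 1\<close>, so applying the uniform estimate with exponent \<open>\<alpha> - \<beta>\<close> to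
  the increments of \<open>x\<close> bounds the \<open>\<beta>\<close>-Favard norm of the error at \<open>x\<close>. The hypothesis on compact
  subsets of \<open>I\<close> covers both \<open>I = {0..}\<close> with \<open>\<kappa> = 1\<close> and \<open>I = {0<..}\<close>.\<close>
theorem truncated_inversion_convergence:
  assumes k: "0 \<le> \<kappa>" "\<kappa> \<le> 1" and w: "\<omega> > \<omega>\<^sub>0" and a: "0 < \<alpha>" "\<alpha> \<le> 1" and x: "x \<in> favard_space S \<alpha>"
    and I: "\<And>K. compact K \<Longrightarrow> K \<subseteq> I \<Longrightarrow> \<exists>\<tau>>0. \<exists>T. \<forall>t\<in>K. 0 \<le> t \<and> t \<le> T \<and> (\<tau> \<le> t \<or> \<kappa> = 1)"
    and I0: "I \<subseteq> {0..}"
    and J: "\<And>R t. R > 0 \<Longrightarrow> J R t = truncated_inversion \<kappa> \<omega> R t x"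
    and l: "\<And>t. l t = S t x - (\<kappa> * exp (\<omega>\<^sub>0 * t)) *\<^sub>R x"
  shows "loc_uniform_limit I J l at_top"
    and "0 < \<beta> \<Longrightarrow> \<beta> < \<alpha> \<Longrightarrow> favard_loc_uniform_limit S \<beta> I J l at_top"
proof -
  obtain m1 where m1: "0 \<le> m1" "\<And>h. h > 0 \<Longrightarrow> norm (S h x - x) \<le> m1 * h powr \<alpha>"
    by (rule favard_space_boundE[OF x]) (rule that)
  define m where "m = max m1 (norm x) + 1"
  have m: "m > 0" "norm x \<le> m" using m1(1) by (auto simp: m_def)
  have hoelder: "norm (S h x - x) \<le> m * h powr \<alpha>" if "h > 0" for h
  proof -
    have "m1 * h powr \<alpha> \<le> m * h powr \<alpha>" by (intro mult_right_mono) (auto simp: m_def)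
    then show ?thesis using m1(2)[OF that] by simp
  qed
  have hoelder0: "\<forall>s\<in>{0..1}. norm (S s x - x) \<le> m * s powr \<alpha>"
  proof
    fix s :: real assume "s \<in> {0..1}"
    then show "norm (S s x - x) \<le> m * s powr \<alpha>" using hoelder[of s] by (cases "s = 0") auto
  qed
  show "loc_uniform_limit I J l at_top"
    unfolding loc_uniform_limit_def uniform_limit_iff
  proof (intro allI impI)
    fix K and e :: real assume K: "compact K \<and> K \<subseteq> I" and e: "e > 0"
    obtain \<tau> T where tau: "\<tau> > 0" and T: "\<And>t. t \<in> K \<Longrightarrow> 0 \<le> t \<and> t \<le> T \<and> (\<tau> \<le> t \<or> \<kappa> = 1)"
      using I K by meson
    have "e / (2 * m) > 0" using e m by simp
    from uniform_truncated_inversion[OF k w a tau this, of T] eventually_gt_at_top[of 0]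
    show "\<forall>\<^sub>F R in at_top. \<forall>t\<in>K. dist (J R t) (l t) < e"
    proof eventually_elim
      case (elim R)
      show ?case
      proof
        fix t assume t: "t \<in> K"
        have "norm (J R t - l t) \<le> e / (2 * m) * m"
          unfolding J[OF elim(2)] l using elim(1)[rule_format, OF m(2) hoelder0[rule_format]] T[OF t] by blast
        also have "\<dots> < e" using m e by simp
        finally show "dist (J R t) (l t) < e" by (simp add: dist_norm)
      qed
    qed
  qed
  assume b: "0 < \<beta>" "\<beta> < \<alpha>"
  define M where "M = (\<lambda>h. (C + 1) * m * h powr \<beta>)"
  have incr: "norm (S h x - x) \<le> M h"
      "\<And>s. s \<ge> 0 \<Longrightarrow> norm (S s (S h x - x) - (S h x - x)) \<le> M h * s powr (\<alpha> - \<beta>)" if "h > 0" for h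
    using norm_increment_le[OF m(2) hoelder b that] increment_hoelder[OF m(2) hoelder b that]
    by (simp_all add: M_def)
  have l_diff: "S h (l t) - l t = S t (S h x - x) - (\<kappa> * exp (\<omega>\<^sub>0 * t)) *\<^sub>R (S h x - x)" if "h > 0" "t \<ge> 0" for h t
  proof -
    have "S h (r *\<^sub>R x) = r *\<^sub>R S h x" for r
      using linear_scale[OF bounded_linear.linear[OF S_linear[of h]]] that by simp
    then show ?thesis
      using that by (simp add: l S_diff S_commute[of t h] algebra_simps)
  qed
  show "favard_loc_uniform_limit S \<beta> I J l at_top"
    unfolding favard_loc_uniform_limit_def
  proof (intro conjI ballI allI impI)
    fix t assume "t \<in> I"
    then have t: "t \<ge> 0" using I0 by auto
    have "favard_norm S \<beta> (l t) \<le> ennreal ((C + 1) * ((C + 1) * m))"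
    proof (rule favard_norm_le)
      fix h :: real assume h: "h > 0"
      have "norm (S h (l t) - l t) \<le> norm (S t (S h x - x)) + norm ((\<kappa> * exp (\<omega>\<^sub>0 * t)) *\<^sub>R (S h x - x))"
        unfolding l_diff[OF h t] by (rule norm_triangle_ineq4)
      also have "\<dots> \<le> C * norm (S h x - x) + (1 * 1) * norm (S h x - x)"
        unfolding norm_scaleR abs_mult
        by (intro add_mono norm_S_le t mult_right_mono mult_mono) (use k t neg in \<open>auto simp: mult_nonpos_nonneg\<close>)
      also have "\<dots> = (C + 1) * norm (S h x - x)" by (simp add: algebra_simps)
      also have "\<dots> \<le> (C + 1) * M h" using incr(1)[OF h] C_pos by simp
      finally show "norm (S h (l t) - l t) \<le> (C + 1) * ((C + 1) * m) * h powr \<beta>"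
        by (simp add: M_def mult_ac)
    qed
    then show "l t \<in> favard_space S \<beta>"
      unfolding favard_space_def using le_less_trans[OF _ ennreal_less_top] by auto
  next
    fix K and e :: real assume K: "compact K \<and> K \<subseteq> I" and e: "e > 0"
    obtain \<tau> T where tau: "\<tau> > 0" and T: "\<And>t. t \<in> K \<Longrightarrow> 0 \<le> t \<and> t \<le> T \<and> (\<tau> \<le> t \<or> \<kappa> = 1)"
      using I K by meson
    define r where "r = e / (2 * ((C + 1) * m))"
    have r: "r > 0" using e m C_pos by (simp add: r_def)
    have ab: "0 < \<alpha> - \<beta>" "\<alpha> - \<beta> \<le> 1" using a b by auto
    from uniform_truncated_inversion[OF k w ab tau r, of T] eventually_gt_at_top[of 0]
    show "\<forall>\<^sub>F R in at_top. \<forall>t\<in>K. favard_norm S \<beta> (J R t - l t) < ennreal e"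
    proof eventually_elim
      case (elim R)
      show ?case
      proof
        fix t assume t: "t \<in> K"
        have t0: "0 \<le> t" using T[OF t] by simp
        have "favard_norm S \<beta> (J R t - l t) \<le> ennreal (r * ((C + 1) * m))"
        proof (rule favard_norm_le)
          fix h :: real assume h: "h > 0"
          have "S h (J R t - l t) - (J R t - l t) = (S h (J R t) - J R t) - (S h (l t) - l t)"
            using h by (simp add: S_diff)
          also have "\<dots> = truncated_inversion \<kappa> \<omega> R t (S h x - x)
              - (S t (S h x - x) - (\<kappa> * exp (\<omega>\<^sub>0 * t)) *\<^sub>R (S h x - x))"
            unfolding l_diff[OF h t0] J[OF elim(2)]
            using truncated_inversion_S_diff[OF k w elim(2), of h t x] h by simp
          also have "norm \<dots> \<le> r * M h"
            using elim(1)[rule_format, OF incr(1)[OF h], of t] incr(2)[OF h] T[OF t] by auto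
          finally show "norm (S h (J R t - l t) - (J R t - l t)) \<le> r * ((C + 1) * m) * h powr \<beta>"
            by (simp add: M_def mult_ac)
        qed
        also have "\<dots> < ennreal e"
          using e m C_pos by (intro ennreal_lessI) (simp_all add: r_def)
        finally show "favard_norm S \<beta> (J R t - l t) < ennreal e" .
      qed
    qed
  qed
qed

end

lemma compact_subset_Ioi_bounds:
  fixes K :: "real set"
  assumes "compact K" "K \<subseteq> {0<..}"
  shows "\<exists>\<tau>>0. \<exists>T. \<forall>t\<in>K. \<tau> \<le> t \<and> t \<le> T"
proof (cases "K = {}")
  case False
  obtain a where a: "a \<in> K" "\<forall>t\<in>K. a \<le> t" using compact_attains_inf[OF assms(1) False] by blast
  obtain b where b: "\<forall>t\<in>K. t \<le> b" using compact_attains_sup[OF assms(1) False] by blast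
  show ?thesis using a b assms(2) by (intro exI[of _ a]) auto
qed (auto intro: exI[of _ 1])

lemma exp_growth_bound_norm_le:
  assumes "C0_semigroup S" "exp_growth_bound S w"
  obtains C where "C > 0" "\<And>t y. t \<ge> 0 \<Longrightarrow> norm (S t y) \<le> C * exp (w * t) * norm y"
proof -
  obtain C where C: "C > 0" "\<forall>t\<ge>0. onorm (S t) \<le> C * exp (w * t)"
    using assms(2) by (auto simp: exp_growth_bound_def)
  show ?thesis
  proof (rule that[OF C(1)])
    fix t :: real and y assume t: "t \<ge> 0"
    have "bounded_linear (S t)"
      using assms(1) t by (simp add: C0_semigroup_def bounded_clinear_def)
    then have "norm (S t y) \<le> onorm (S t) * norm y" by (rule onorm)
    also have "\<dots> \<le> C * exp (w * t) * norm y" using C(2) t by (intro mult_right_mono) auto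
    finally show "norm (S t y) \<le> C * exp (w * t) * norm y" .
  qed
qed

theorem corollary3p3:
  fixes S :: "real \<Rightarrow> 'a::cbanach \<Rightarrow> 'a"
    and A :: "'a \<Rightarrow> 'a" and D :: "'a set"
    and \<omega>\<^sub>0 \<omega> \<alpha> :: real and x :: 'a
  assumes "C0_semigroup S"
    and "is_generator D A S"
    and "exp_growth_bound S \<omega>\<^sub>0" and "\<omega>\<^sub>0 < 0"
    and "0 < \<alpha>" and "\<alpha> \<le> 1"
    and "\<omega> > \<omega>\<^sub>0"
    and "x \<in> favard_space S \<alpha>"
  defines "I1 \<equiv> (\<lambda>R t. (1 / (2 * of_real pi * \<i>)) *\<^sub>C
      vcontour_integral
        (\<lambda>z. exp (z * of_real t) *\<^sub>C
           (resolvent D A z x - (1 / (z - of_real \<omega>\<^sub>0)) *\<^sub>C x))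
        (linepath (Complex \<omega> (- R)) (Complex \<omega> R)))"
    and "I2 \<equiv> (\<lambda>R t. (1 / (2 * of_real pi * \<i>)) *\<^sub>C
      vcontour_integral
        (\<lambda>z. exp (z * of_real t) *\<^sub>C resolvent D A z x)
        (linepath (Complex \<omega> (- R)) (Complex \<omega> R)))"
  shows "loc_uniform_limit {0..} I1 (\<lambda>t. S t x - exp (\<omega>\<^sub>0 * t) *\<^sub>R x) at_top
    \<and> (\<forall>\<alpha>'. 0 < \<alpha>' \<and> \<alpha>' < \<alpha> \<longrightarrow>
        favard_loc_uniform_limit S \<alpha>' {0..} I1 (\<lambda>t. S t x - exp (\<omega>\<^sub>0 * t) *\<^sub>R x) at_top)
    \<and> loc_uniform_limit {0<..} I2 (\<lambda>t. S t x) at_top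
    \<and> (\<forall>\<alpha>'. 0 < \<alpha>' \<and> \<alpha>' < \<alpha> \<longrightarrow>
        favard_loc_uniform_limit S \<alpha>' {0<..} I2 (\<lambda>t. S t x) at_top)"
proof -
  obtain C where C: "C > 0" "\<And>t y. t \<ge> 0 \<Longrightarrow> norm (S t y) \<le> C * exp (\<omega>\<^sub>0 * t) * norm y"
    by (rule exp_growth_bound_norm_le[OF assms(1,3)]) (rule that)
  interpret decaying_semigroup S \<omega>\<^sub>0 C
    by standard (use assms(1,4) C in auto)
  have J1: "I1 R t = truncated_inversion 1 \<omega> R t x" if "R > 0" for R t
    using truncated_inversion_eq_contour_integral[OF assms(2) _ _ assms(7) that, of 1 t x]
    by (simp add: I1_def)
  have J2: "I2 R t = truncated_inversion 0 \<omega> R t x" if "R > 0" for R t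
    using truncated_inversion_eq_contour_integral[OF assms(2) _ _ assms(7) that, of 0 t x]
    by (simp add: I2_def)
  have K1: "\<exists>\<tau>>0. \<exists>T. \<forall>t\<in>K. 0 \<le> t \<and> t \<le> T \<and> (\<tau> \<le> t \<or> (1::real) = 1)"
    if "compact K" "K \<subseteq> {0..}" for K :: "real set"
    using bounded_has_Sup(1)[OF compact_imp_bounded[OF that(1)]] that(2)
    by (intro exI[of _ 1] conjI zero_less_one exI[of _ "Sup K"]) auto
  have K2: "\<exists>\<tau>>0. \<exists>T. \<forall>t\<in>K. 0 \<le> t \<and> t \<le> T \<and> (\<tau> \<le> t \<or> (0::real) = 1)"
    if "compact K" "K \<subseteq> {0<..}" for K :: "real set"
    using compact_subset_Ioi_bounds[OF that] by (meson less_imp_le order_trans)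
  note conv1 = truncated_inversion_convergence[OF zero_le_one order_refl assms(7,5,6,8) K1 order_refl J1,
      of "\<lambda>t. S t x - exp (\<omega>\<^sub>0 * t) *\<^sub>R x", simplified]
  have sub: "{0<..} \<subseteq> {0::real..}" by auto
  note conv2 = truncated_inversion_convergence[OF order_refl zero_le_one assms(7,5,6,8) K2 sub J2,
      of "\<lambda>t. S t x", simplified]
  show ?thesis using conv1 conv2 by blast
qed

end
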